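(* Let $(M,J,g)$ be an almost Hermitian manifold and fix a local unitary $(1,0)$-frame. Then for all $i,j,k,l\in\{1,\dots,n\}$ $$\begin{aligned}R^L_{ijkl}=&\frac12\left(\tau_{kl;i}^{\bar j}-\tau_{kl;j}^{\bar i}\right)+\frac12\left(\tau_{ij;k}^{\bar l}-\tau_{ij;l}^{\bar k}\right)+\frac12\left(\tau_{ij}^\lambda\tau_{kl}^{\bar\lambda}+\tau_{ij}^{\bar\lambda}\tau_{kl}^\lambda\right)\\&+\frac14\tau_{ik}^\lambda\left(\tau_{jl}^{\bar\lambda}-\tau_{l\lambda}^{\bar j}-\tau_{\lambda j}^{\bar l}\right)+\frac14\tau_{jl}^\lambda\left(\tau_{ik}^{\bar\lambda}-\tau_{k\lambda}^{\bar i}-\tau_{\lambda i}^{\bar k}\right)\\&-\frac14\tau_{il}^\lambda\left(\tau_{jk}^{\bar\lambda}-\tau_{k\lambda}^{\bar j}-\tau_{\lambda j}^{\bar k}\right)-\frac14\tau_{jk}^\lambda\left(\tau_{il}^{\bar\lambda}-\tau_{l\lambda}^{\bar i}-\tau_{\lambda i}^{\bar l}\right).\end{aligned}$$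
   Context: An almost Hermitian manifold $(M,J,g)$ is a manifold $M$ of real dimension $2n$ with an almost complex structure $J$ and a Riemannian metric $g$ satisfying $g(JX,JY)=g(X,Y)$. Write $\langle\cdot,\cdot\rangle$ for the complex bilinear extension of $g$ to $TM\otimes\mathbb C$. The torsion of a connection $\nabla$ is $\tau(X,Y)=\nabla_XY-\nabla_YX-[X,Y]$. The canonical connection $\nabla$ is the unique connection with $\nabla g=0$, $\nabla J=0$ and $\tau(X,\overline Y)=0$ for all $(1,0)$-vectors $X,Y$ (tensors and connections are extended complex linearly); $\tau$ denotes its torsion. $R^L$ denotes the curvature tensor of the Levi-Civita connection $D$: $R^L(X,Y)Z=D_XD_YZ-D_YD_XZ-D_{[X,Y]}Z$ and $R^L(X,Y,Z,W)=\langle R^L(Z,W)X,Y\rangle$. A local unitary $(1,0)$-frame $(e_1,\dots,e_n)$ is a local frame of $T^{1,0}M$ with $\langle e_i,\overline{e_j}\rangle=\delta_{ij}$; $e_{\bar i}=\overline{e_i}$. For $A,B,C,D\in\{1,\bar1,\dots,n,\bar n\}$: $R^L_{ABCD}=R^L(e_A,e_B,e_C,e_D)$, $\tau(e_A,e_B)=\sum_C\tau_{AB}^Ce_C$, and ";" denotes covariant derivatives with respect to the canonical connection $\nabla$: $(\nabla_{e_C}\tau)(e_A,e_B)=\sum_D\tau_{AB;C}^De_D$. A Greek index $\lambda$ occurring in a product is summed over $1,\dots,n$. *)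

theory Defs
  imports "HOL-Analysis.Analysis"
begin

section \<open>Smooth manifolds\<close>

text \<open>Only used for open \<open>S\<close>, where \<open>frechet_derivative f (at x)\<close> is the derivative
  at every \<open>x \<in> S\<close>. On a finite-dimensional space this is the usual \<open>C\<^sup>k\<close> condition, as the
  directional derivatives in all directions are required to be \<open>C\<^sup>k\<^sup>-\<^sup>1\<close>.\<close>

primrec Ck_on :: "nat \<Rightarrow> ('a::real_normed_vector \<Rightarrow> 'b::real_normed_vector) \<Rightarrow> 'a set \<Rightarrow> bool" where
  "Ck_on 0 f S \<longleftrightarrow> continuous_on S f"
| "Ck_on (Suc k) f S \<longleftrightarrow>
     f differentiable_on S \<and> (\<forall>v. Ck_on k (\<lambda>x. frechet_derivative f (at x) v) S)"

definition smooth_on :: "('a::real_normed_vector \<Rightarrow> 'b::real_normed_vector) \<Rightarrow> 'a set \<Rightarrow> bool" where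
  "smooth_on f S \<longleftrightarrow> (\<forall>k. Ck_on k f S)"

text \<open>A chart is a pair \<open>(V, \<phi>)\<close>: a domain and a map into the model space \<open>'e\<close>, whose dimension
  is the dimension of the manifold. Values of \<open>\<phi>\<close> outside \<open>V\<close> are irrelevant.\<close>

record ('a, 'e) manifold =
  mtop :: "'a topology"
  atlas :: "('a set \<times> ('a \<Rightarrow> 'e)) set"

locale smooth_manifold =
  fixes M :: "('a, 'e::euclidean_space) manifold"
  assumes hausdorff: "Hausdorff_space (mtop M)"
    and second_countable: "second_countable (mtop M)"
    and chart_domain: "(V, \<phi>) \<in> atlas M \<Longrightarrow> openin (mtop M) V"
    and chart_range: "(V, \<phi>) \<in> atlas M \<Longrightarrow> open (\<phi> ` V)"
    and chart_homeo: "(V, \<phi>) \<in> atlas M \<Longrightarrow>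
          homeomorphic_map (subtopology (mtop M) V) (top_of_set (\<phi> ` V)) \<phi>"
    and charts_cover: "topspace (mtop M) = (\<Union>(V, \<phi>)\<in>atlas M. V)"
    and charts_compatible: "\<lbrakk>(V, \<phi>) \<in> atlas M; (W, \<psi>) \<in> atlas M\<rbrakk> \<Longrightarrow>
          smooth_on (\<psi> \<circ> inv_into V \<phi>) (\<phi> ` (V \<inter> W))"

definition smooth_fun :: "('a, 'e::euclidean_space) manifold \<Rightarrow> 'a set \<Rightarrow> ('a \<Rightarrow> real) \<Rightarrow> bool" where
  "smooth_fun M U f \<longleftrightarrow>
     openin (mtop M) U \<and>
     (\<forall>(V, \<phi>)\<in>atlas M. smooth_on (f \<circ> inv_into V \<phi>) (\<phi> ` (U \<inter> V)))"

definition smooth_near :: "('a, 'e::euclidean_space) manifold \<Rightarrow> 'a \<Rightarrow> ('a \<Rightarrow> real) \<Rightarrow> bool" where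
  "smooth_near M p f \<longleftrightarrow> (\<exists>U. p \<in> U \<and> smooth_fun M U f)"


section \<open>Tangent vectors and vector fields\<close>

text \<open>A tangent vector at \<open>p\<close> is a derivation of the algebra of germs at \<open>p\<close> of smooth functions.
  A germ is represented by any function that is smooth near \<open>p\<close>. Derivations are extended by \<open>0\<close> to
  all other functions, so that equal tangent vectors are equal as HOL functions.\<close>

type_synonym 'a tvec = "('a \<Rightarrow> real) \<Rightarrow> real"

definition tangent_space :: "('a, 'e::euclidean_space) manifold \<Rightarrow> 'a \<Rightarrow> 'a tvec set" where
  "tangent_space M p = {v.
     (\<forall>f. \<not> smooth_near M p f \<longrightarrow> v f = 0) \<and>
     (\<forall>U f h. openin (mtop M) U \<and> p \<in> U \<and> (\<forall>q\<in>U. f q = h q) \<longrightarrow> v f = v h) \<and>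
     (\<forall>a f h. smooth_near M p f \<and> smooth_near M p h \<longrightarrow>
        v (\<lambda>q. a * f q + h q) = a * v f + v h) \<and>
     (\<forall>f h. smooth_near M p f \<and> smooth_near M p h \<longrightarrow>
        v (\<lambda>q. f q * h q) = v f * h p + f p * v h)}"

text \<open>Vector fields over an open set \<open>U\<close>; their values outside \<open>U\<close> are irrelevant.\<close>

definition vector_field :: "('a, 'e::euclidean_space) manifold \<Rightarrow> 'a set \<Rightarrow> ('a \<Rightarrow> 'a tvec) \<Rightarrow> bool" where
  "vector_field M U X \<longleftrightarrow>
     openin (mtop M) U \<and>
     (\<forall>p\<in>U. X p \<in> tangent_space M p) \<and>
     (\<forall>V f. V \<subseteq> U \<and> smooth_fun M V f \<longrightarrow> smooth_fun M V (\<lambda>p. X p f))"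

definition lie_bracket ::
    "('a, 'e::euclidean_space) manifold \<Rightarrow> ('a \<Rightarrow> 'a tvec) \<Rightarrow> ('a \<Rightarrow> 'a tvec) \<Rightarrow> 'a \<Rightarrow> 'a tvec" where
  "lie_bracket M X Y p =
     (\<lambda>f. if smooth_near M p f then X p (\<lambda>q. Y q f) - Y p (\<lambda>q. X q f) else 0)"


section \<open>Almost Hermitian manifolds\<close>

locale almost_hermitian_manifold = smooth_manifold M
  for n :: nat
    and M :: "('a, 'e::euclidean_space) manifold"
    and J :: "'a \<Rightarrow> 'a tvec \<Rightarrow> 'a tvec"
    and g :: "'a \<Rightarrow> 'a tvec \<Rightarrow> 'a tvec \<Rightarrow> real" +
  assumes dim: "DIM('e) = 2 * n"
    and J_closed: "\<lbrakk>p \<in> topspace (mtop M); v \<in> tangent_space M p\<rbrakk> \<Longrightarrow> J p v \<in> tangent_space M p"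
    and J_linear: "\<lbrakk>p \<in> topspace (mtop M); v \<in> tangent_space M p; w \<in> tangent_space M p\<rbrakk> \<Longrightarrow>
          J p (\<lambda>f. a * v f + w f) = (\<lambda>f. a * J p v f + J p w f)"
    and J_smooth: "vector_field M U X \<Longrightarrow> vector_field M U (\<lambda>p. J p (X p))"
    and J_square: "\<lbrakk>p \<in> topspace (mtop M); v \<in> tangent_space M p\<rbrakk> \<Longrightarrow> J p (J p v) = (\<lambda>f. - v f)"
    and g_linear: "\<lbrakk>p \<in> topspace (mtop M); u \<in> tangent_space M p; v \<in> tangent_space M p;
            w \<in> tangent_space M p\<rbrakk> \<Longrightarrow>
          g p (\<lambda>f. a * u f + v f) w = a * g p u w + g p v w"
    and g_sym: "\<lbrakk>p \<in> topspace (mtop M); v \<in> tangent_space M p; w \<in> tangent_space M p\<rbrakk> \<Longrightarrow>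
          g p v w = g p w v"
    and g_pos: "\<lbrakk>p \<in> topspace (mtop M); v \<in> tangent_space M p; v \<noteq> (\<lambda>f. 0)\<rbrakk> \<Longrightarrow> g p v v > 0"
    and g_smooth: "\<lbrakk>vector_field M U X; vector_field M U Y\<rbrakk> \<Longrightarrow>
          smooth_fun M U (\<lambda>p. g p (X p) (Y p))"
    and hermitian: "\<lbrakk>p \<in> topspace (mtop M); v \<in> tangent_space M p; w \<in> tangent_space M p\<rbrakk> \<Longrightarrow>
          g p (J p v) (J p w) = g p v w"


section \<open>Connections\<close>

text \<open>\<open>nab p v Y\<close> is the covariant derivative at \<open>p\<close>, in the direction of the tangent vector \<open>v\<close> at
  \<open>p\<close>, of a vector field \<open>Y\<close> defined on some open neighbourhood of \<open>p\<close>; it depends only on the germ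
  of \<open>Y\<close> at \<open>p\<close>.\<close>

type_synonym 'a conn = "'a \<Rightarrow> 'a tvec \<Rightarrow> ('a \<Rightarrow> 'a tvec) \<Rightarrow> 'a tvec"

locale connection =
  fixes M :: "('a, 'e::euclidean_space) manifold"
    and nab :: "'a conn"
  assumes closed: "\<lbrakk>vector_field M U Y; p \<in> U; v \<in> tangent_space M p\<rbrakk> \<Longrightarrow>
          nab p v Y \<in> tangent_space M p"
    and smooth: "\<lbrakk>vector_field M U X; vector_field M U Y\<rbrakk> \<Longrightarrow>
          vector_field M U (\<lambda>p. nab p (X p) Y)"
    and local: "\<lbrakk>vector_field M U Y; vector_field M U Z; \<And>q. q \<in> U \<Longrightarrow> Y q = Z q;
            p \<in> U; v \<in> tangent_space M p\<rbrakk> \<Longrightarrow> nab p v Y = nab p v Z"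
    and linear: "\<lbrakk>vector_field M U Y; p \<in> U; v \<in> tangent_space M p; w \<in> tangent_space M p\<rbrakk> \<Longrightarrow>
          nab p (\<lambda>f. a * v f + w f) Y = (\<lambda>f. a * nab p v Y f + nab p w Y f)"
    and additive: "\<lbrakk>vector_field M U Y; vector_field M U Z; p \<in> U; v \<in> tangent_space M p\<rbrakk> \<Longrightarrow>
          nab p v (\<lambda>q f. Y q f + Z q f) = (\<lambda>f. nab p v Y f + nab p v Z f)"
    and leibniz: "\<lbrakk>vector_field M U Y; smooth_fun M U h; p \<in> U; v \<in> tangent_space M p\<rbrakk> \<Longrightarrow>
          nab p v (\<lambda>q f. h q * Y q f) = (\<lambda>f. v h * Y p f + h p * nab p v Y f)"

definition torsion ::
    "('a, 'e::euclidean_space) manifold \<Rightarrow> 'a conn \<Rightarrow> ('a \<Rightarrow> 'a tvec) \<Rightarrow> ('a \<Rightarrow> 'a tvec) \<Rightarrow> 'a \<Rightarrow> 'a tvec"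
  where
  "torsion M nab X Y p = (\<lambda>f. nab p (X p) Y f - nab p (Y p) X f - lie_bracket M X Y p f)"

definition metric_parallel ::
    "('a, 'e::euclidean_space) manifold \<Rightarrow> ('a \<Rightarrow> 'a tvec \<Rightarrow> 'a tvec \<Rightarrow> real) \<Rightarrow> 'a conn \<Rightarrow> bool"
  where
  "metric_parallel M g nab \<longleftrightarrow>
     (\<forall>U Y Z p v. vector_field M U Y \<and> vector_field M U Z \<and> p \<in> U \<and> v \<in> tangent_space M p \<longrightarrow>
        v (\<lambda>q. g q (Y q) (Z q)) - g p (nab p v Y) (Z p) - g p (Y p) (nab p v Z) = 0)"

definition J_parallel ::
    "('a, 'e::euclidean_space) manifold \<Rightarrow> ('a \<Rightarrow> 'a tvec \<Rightarrow> 'a tvec) \<Rightarrow> 'a conn \<Rightarrow> bool" where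
  "J_parallel M J nab \<longleftrightarrow>
     (\<forall>U Y p v. vector_field M U Y \<and> p \<in> U \<and> v \<in> tangent_space M p \<longrightarrow>
        (\<lambda>f. nab p v (\<lambda>q. J q (Y q)) f - J p (nab p v Y) f) = (\<lambda>f. 0))"

definition levi_civita_connection ::
    "('a, 'e::euclidean_space) manifold \<Rightarrow> ('a \<Rightarrow> 'a tvec \<Rightarrow> 'a tvec \<Rightarrow> real) \<Rightarrow> 'a conn \<Rightarrow> bool"
  where
  "levi_civita_connection M g D \<longleftrightarrow>
     connection M D \<and> metric_parallel M g D \<and>
     (\<forall>U X Y. vector_field M U X \<and> vector_field M U Y \<longrightarrow>
        (\<forall>p\<in>U. torsion M D X Y p = (\<lambda>f. 0)))"


section \<open>Complexification\<close>

text \<open>An element \<open>v + \<i>w\<close> of the complexified tangent space (\<open>v\<close>, \<open>w\<close> real tangent vectors) is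
  represented by the complex-valued functional \<open>\<lambda>f. v f + \<i> * w f\<close>, so that complex linear
  combinations and conjugation are pointwise; \<open>re\<close> and \<open>im\<close> recover \<open>v\<close> and \<open>w\<close>.\<close>

type_synonym 'a ctvec = "('a \<Rightarrow> real) \<Rightarrow> complex"

definition re :: "'a ctvec \<Rightarrow> 'a tvec" where "re v = (\<lambda>f. Re (v f))"
definition im :: "'a ctvec \<Rightarrow> 'a tvec" where "im v = (\<lambda>f. Im (v f))"

definition ctangent_space :: "('a, 'e::euclidean_space) manifold \<Rightarrow> 'a \<Rightarrow> 'a ctvec set" where
  "ctangent_space M p = {v. re v \<in> tangent_space M p \<and> im v \<in> tangent_space M p}"

definition cvector_field :: "('a, 'e::euclidean_space) manifold \<Rightarrow> 'a set \<Rightarrow> ('a \<Rightarrow> 'a ctvec) \<Rightarrow> bool"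
  where
  "cvector_field M U X \<longleftrightarrow>
     vector_field M U (\<lambda>p. re (X p)) \<and> vector_field M U (\<lambda>p. im (X p))"

definition conj_field :: "('a \<Rightarrow> 'a ctvec) \<Rightarrow> 'a \<Rightarrow> 'a ctvec" where
  "conj_field X p = (\<lambda>f. cnj (X p f))"

definition cJ :: "('a \<Rightarrow> 'a tvec \<Rightarrow> 'a tvec) \<Rightarrow> 'a \<Rightarrow> 'a ctvec \<Rightarrow> 'a ctvec" where
  "cJ J p v = (\<lambda>f. Complex (J p (re v) f) (J p (im v) f))"

definition cmetric ::
    "('a \<Rightarrow> 'a tvec \<Rightarrow> 'a tvec \<Rightarrow> real) \<Rightarrow> 'a \<Rightarrow> 'a ctvec \<Rightarrow> 'a ctvec \<Rightarrow> complex" where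
  "cmetric g p v w =
     Complex (g p (re v) (re w) - g p (im v) (im w)) (g p (re v) (im w) + g p (im v) (re w))"

text \<open>The complex bilinear extension of an operation \<open>B\<close> taking two real vector fields to a tangent
  vector at some point.\<close>

definition cbilinear ::
    "(('a \<Rightarrow> 'a tvec) \<Rightarrow> ('a \<Rightarrow> 'a tvec) \<Rightarrow> 'a tvec) \<Rightarrow> ('a \<Rightarrow> 'a ctvec) \<Rightarrow> ('a \<Rightarrow> 'a ctvec) \<Rightarrow> 'a ctvec"
  where
  "cbilinear B X Y = (\<lambda>f. Complex
     (B (\<lambda>q. re (X q)) (\<lambda>q. re (Y q)) f - B (\<lambda>q. im (X q)) (\<lambda>q. im (Y q)) f)
     (B (\<lambda>q. re (X q)) (\<lambda>q. im (Y q)) f + B (\<lambda>q. im (X q)) (\<lambda>q. re (Y q)) f))"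

definition clie_bracket ::
    "('a, 'e::euclidean_space) manifold \<Rightarrow> ('a \<Rightarrow> 'a ctvec) \<Rightarrow> ('a \<Rightarrow> 'a ctvec) \<Rightarrow> 'a \<Rightarrow> 'a ctvec" where
  "clie_bracket M X Y p = cbilinear (\<lambda>X Y. lie_bracket M X Y p) X Y"

definition cnabla :: "'a conn \<Rightarrow> ('a \<Rightarrow> 'a ctvec) \<Rightarrow> ('a \<Rightarrow> 'a ctvec) \<Rightarrow> 'a \<Rightarrow> 'a ctvec" where
  "cnabla nab X Y p = cbilinear (\<lambda>X Y. nab p (X p) Y) X Y"

definition ctorsion ::
    "('a, 'e::euclidean_space) manifold \<Rightarrow> 'a conn \<Rightarrow> ('a \<Rightarrow> 'a ctvec) \<Rightarrow> ('a \<Rightarrow> 'a ctvec) \<Rightarrow> 'a \<Rightarrow> 'a ctvec"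
  where
  "ctorsion M nab X Y p = cbilinear (\<lambda>X Y. torsion M nab X Y p) X Y"

definition ctorsion_deriv ::
    "('a, 'e::euclidean_space) manifold \<Rightarrow> 'a conn \<Rightarrow>
     ('a \<Rightarrow> 'a ctvec) \<Rightarrow> ('a \<Rightarrow> 'a ctvec) \<Rightarrow> ('a \<Rightarrow> 'a ctvec) \<Rightarrow> 'a \<Rightarrow> 'a ctvec" where
  \<comment> \<open>\<open>(\<nabla>\<^sub>X \<tau>)(Y, Z)\<close>\<close>
  "ctorsion_deriv M nab X Y Z p = (\<lambda>f.
     cnabla nab X (ctorsion M nab Y Z) p f
     - ctorsion M nab (cnabla nab X Y) Z p f
     - ctorsion M nab Y (cnabla nab X Z) p f)"

text \<open>The curvature formula applied to the complex extensions of the connection and of the bracket;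
  being complex trilinear, it is the complex trilinear extension of the real curvature tensor.\<close>

definition ccurvature ::
    "('a, 'e::euclidean_space) manifold \<Rightarrow> 'a conn \<Rightarrow>
     ('a \<Rightarrow> 'a ctvec) \<Rightarrow> ('a \<Rightarrow> 'a ctvec) \<Rightarrow> ('a \<Rightarrow> 'a ctvec) \<Rightarrow> 'a \<Rightarrow> 'a ctvec" where
  \<comment> \<open>\<open>R(X, Y)Z\<close>\<close>
  "ccurvature M D X Y Z p = (\<lambda>f.
     cnabla D X (cnabla D Y Z) p f - cnabla D Y (cnabla D X Z) p f
     - cnabla D (clie_bracket M X Y) Z p f)"

definition curvature4 ::
    "('a, 'e::euclidean_space) manifold \<Rightarrow> ('a \<Rightarrow> 'a tvec \<Rightarrow> 'a tvec \<Rightarrow> real) \<Rightarrow> 'a conn \<Rightarrow>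
     ('a \<Rightarrow> 'a ctvec) \<Rightarrow> ('a \<Rightarrow> 'a ctvec) \<Rightarrow> ('a \<Rightarrow> 'a ctvec) \<Rightarrow> ('a \<Rightarrow> 'a ctvec) \<Rightarrow> 'a \<Rightarrow> complex" where
  \<comment> \<open>\<open>R(X, Y, Z, W) = \<langle>R(Z, W)X, Y\<rangle>\<close>\<close>
  "curvature4 M g D X Y Z W p = cmetric g p (ccurvature M D Z W X p) (Y p)"

definition T10 ::
    "('a, 'e::euclidean_space) manifold \<Rightarrow> ('a \<Rightarrow> 'a tvec \<Rightarrow> 'a tvec) \<Rightarrow> 'a \<Rightarrow> 'a ctvec set" where
  "T10 M J p = {v \<in> ctangent_space M p. cJ J p v = (\<lambda>f. \<i> * v f)}"

definition T10_field ::
    "('a, 'e::euclidean_space) manifold \<Rightarrow> ('a \<Rightarrow> 'a tvec \<Rightarrow> 'a tvec) \<Rightarrow> 'a set \<Rightarrow> ('a \<Rightarrow> 'a ctvec) \<Rightarrow> bool"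
  where
  "T10_field M J U X \<longleftrightarrow> cvector_field M U X \<and> (\<forall>p\<in>U. X p \<in> T10 M J p)"

definition canonical_connection ::
    "('a, 'e::euclidean_space) manifold \<Rightarrow> ('a \<Rightarrow> 'a tvec \<Rightarrow> 'a tvec) \<Rightarrow>
     ('a \<Rightarrow> 'a tvec \<Rightarrow> 'a tvec \<Rightarrow> real) \<Rightarrow> 'a conn \<Rightarrow> bool" where
  "canonical_connection M J g nab \<longleftrightarrow>
     connection M nab \<and> metric_parallel M g nab \<and> J_parallel M J nab \<and>
     (\<forall>U X Y. T10_field M J U X \<and> T10_field M J U Y \<longrightarrow>
        (\<forall>p\<in>U. ctorsion M nab X (conj_field Y) p = (\<lambda>f. 0)))"


section \<open>Unitary frames and components\<close>

definition unitary_frame ::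
    "nat \<Rightarrow> ('a, 'e::euclidean_space) manifold \<Rightarrow> ('a \<Rightarrow> 'a tvec \<Rightarrow> 'a tvec) \<Rightarrow>
     ('a \<Rightarrow> 'a tvec \<Rightarrow> 'a tvec \<Rightarrow> real) \<Rightarrow> 'a set \<Rightarrow> (nat \<Rightarrow> 'a \<Rightarrow> 'a ctvec) \<Rightarrow> bool" where
  "unitary_frame n M J g U e \<longleftrightarrow>
     openin (mtop M) U \<and>
     (\<forall>i\<in>{1..n}. T10_field M J U (e i)) \<and>
     (\<forall>p\<in>U. \<forall>v\<in>T10 M J p. \<exists>c. v = (\<lambda>f. \<Sum>i=1..n. c i * e i p f)) \<and>
     (\<forall>p\<in>U. \<forall>c. (\<lambda>f. \<Sum>i=1..n. c i * e i p f) = (\<lambda>f. 0) \<longrightarrow> (\<forall>i\<in>{1..n}. c i = 0)) \<and>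
     (\<forall>p\<in>U. \<forall>i\<in>{1..n}. \<forall>j\<in>{1..n}.
        cmetric g p (e i p) (conj_field (e j) p) = (if i = j then 1 else 0))"

text \<open>The index set \<open>{1, 1\<bar>, \<dots>, n, n\<bar>}\<close>.\<close>

datatype index = Hol nat | Bar nat

definition indices :: "nat \<Rightarrow> index set" where
  "indices n = Hol ` {1..n} \<union> Bar ` {1..n}"

primrec full_frame :: "(nat \<Rightarrow> 'a \<Rightarrow> 'a ctvec) \<Rightarrow> index \<Rightarrow> 'a \<Rightarrow> 'a ctvec" where
  "full_frame e (Hol i) = e i"
| "full_frame e (Bar i) = conj_field (e i)"

definition frame_coeff ::
    "nat \<Rightarrow> (nat \<Rightarrow> 'a \<Rightarrow> 'a ctvec) \<Rightarrow> 'a \<Rightarrow> 'a ctvec \<Rightarrow> index \<Rightarrow> complex" where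
  "frame_coeff n e p v =
     (THE c. (\<forall>A. A \<notin> indices n \<longrightarrow> c A = 0) \<and>
             v = (\<lambda>f. \<Sum>A\<in>indices n. c A * full_frame e A p f))"

definition torsion_coeff ::
    "('a, 'e::euclidean_space) manifold \<Rightarrow> 'a conn \<Rightarrow> nat \<Rightarrow> (nat \<Rightarrow> 'a \<Rightarrow> 'a ctvec) \<Rightarrow> 'a \<Rightarrow>
     index \<Rightarrow> index \<Rightarrow> index \<Rightarrow> complex" where
  \<comment> \<open>\<open>\<tau>\<close> with lower indices \<open>A B\<close> and upper index \<open>C\<close>\<close>
  "torsion_coeff M nab n e p A B C =
     frame_coeff n e p (ctorsion M nab (full_frame e A) (full_frame e B) p) C"

definition torsion_deriv_coeff ::
    "('a, 'e::euclidean_space) manifold \<Rightarrow> 'a conn \<Rightarrow> nat \<Rightarrow> (nat \<Rightarrow> 'a \<Rightarrow> 'a ctvec) \<Rightarrow> 'a \<Rightarrow>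
     index \<Rightarrow> index \<Rightarrow> index \<Rightarrow> index \<Rightarrow> complex" where
  \<comment> \<open>\<open>\<tau>\<close> with lower indices \<open>A B ; C\<close> (\<open>C\<close> the direction of differentiation) and upper index \<open>E\<close>\<close>
  "torsion_deriv_coeff M nab n e p A B C E =
     frame_coeff n e p
       (ctorsion_deriv M nab (full_frame e C) (full_frame e A) (full_frame e B) p) E"

definition curvature_coeff ::
    "('a, 'e::euclidean_space) manifold \<Rightarrow> ('a \<Rightarrow> 'a tvec \<Rightarrow> 'a tvec \<Rightarrow> real) \<Rightarrow> 'a conn \<Rightarrow>
     (nat \<Rightarrow> 'a \<Rightarrow> 'a ctvec) \<Rightarrow> 'a \<Rightarrow> index \<Rightarrow> index \<Rightarrow> index \<Rightarrow> index \<Rightarrow> complex" where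
  "curvature_coeff M g D e p A B C E =
     curvature4 M g D (full_frame e A) (full_frame e B) (full_frame e C) (full_frame e E) p"

end

theory Submission
  imports Defs
begin

text \<open>Let \<open>A = D - \<nabla>\<close>. Since both connections are metric and \<open>D\<close> is torsion free,
  \<open>S(X, Y, Z) = \<langle>A(X, Y), Z\<rangle>\<close> is skew in \<open>Y, Z\<close> and \<open>\<langle>\<tau>(X, Y), Z\<rangle> = S(Y, X, Z) - S(X, Y, Z)\<close>, so \<open>S\<close> is
  recovered from \<open>\<tau>\<close> as in the Koszul formula, and likewise \<open>\<nabla>S\<close> from \<open>\<nabla>\<tau>\<close>. As \<open>\<nabla>\<close> preserves the
  isotropic bundle \<open>T\<^sup>1\<^sup>,\<^sup>0\<close>, the curvature of \<open>\<nabla>\<close> does not contribute to \<open>\<langle>R\<^sup>L(X, Y)V, W\<rangle>\<close> for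
  \<open>V, W\<close> of type \<open>(1,0)\<close>, which is therefore a combination of \<open>\<nabla>S\<close> and of terms quadratic in \<open>S\<close>.
  The first Bianchi identity of \<open>\<nabla>\<close>, in which the curvature drops out for the same reason, brings the
  derivative terms into the stated form.

  Tensoriality of \<open>\<tau>\<close> is never needed: \<open>S\<close> is pointwise linear in \<open>X\<close> and \<open>Z\<close> by its very form, and
  skewness transfers this to \<open>Y\<close>.\<close>

section \<open>Smooth functions and vector fields\<close>

text \<open>Openness of \<open>S\<close> is essential: \<open>frechet_derivative f (at x)\<close> is
  taken in the whole space, and on an open set it sees only the values of \<open>f\<close> on
  \<open>S\<close>. Coordinate expressions can thus be exchanged although their values off the chart
  image are arbitrary.\<close>

lemma Ck_on_cong:
  assumes "open S" "\<And>x. x \<in> S \<Longrightarrow> f x = h x" "Ck_on k f S"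
  shows "Ck_on k h S"
  using assms(2,3)
proof (induction k arbitrary: f h)
  case 0
  then show ?case
    by (metis (no_types, lifting) Ck_on.simps(1) continuous_on_cong)
next
  case (Suc k)
  have d: "f differentiable_on S" and C: "\<And>v. Ck_on k (\<lambda>x. frechet_derivative f (at x) v) S"
    using Suc.prems by auto
  have D: "(h has_derivative frechet_derivative f (at x)) (at x)" if x: "x \<in> S" for x
  proof -
    have "f differentiable (at x)"
      using d x assms(1) by (simp add: differentiable_on_eq_differentiable_at)
    then show ?thesis
      using has_derivative_transform_within_open[OF _ assms(1) x] Suc.prems(1)
      by (metis frechet_derivative_works)
  qed
  have "h differentiable_on S"
    using D assms(1) by (meson differentiableI differentiable_on_eq_differentiable_at)
  moreover have "frechet_derivative h (at x) = frechet_derivative f (at x)" if "x \<in> S" for x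
    using frechet_derivative_at[OF D[OF that]] by simp
  then have "Ck_on k (\<lambda>x. frechet_derivative h (at x) v) S" for v
    using C by (intro Suc.IH[OF _ C[of v]]) simp
  ultimately show ?case by simp
qed

lemma Ck_on_linear_combination:
  assumes "open S" "Ck_on k f S" "Ck_on k h S"
  shows "Ck_on k (\<lambda>x. c *\<^sub>R f x + h x) S"
  using assms(2,3)
proof (induction k arbitrary: f h)
  case 0
  then show ?case by (auto intro!: continuous_intros)
next
  case (Suc k)
  have D: "((\<lambda>x. c *\<^sub>R f x + h x) has_derivative
      (\<lambda>v. c *\<^sub>R frechet_derivative f (at x) v + frechet_derivative h (at x) v)) (at x)"
    if x: "x \<in> S" for x
  proof -
    have "f differentiable (at x)" "h differentiable (at x)"
      using Suc.prems x assms(1) by (simp_all add: differentiable_on_eq_differentiable_at)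
    then show ?thesis
      by (auto intro!: derivative_eq_intros simp: frechet_derivative_works)
  qed
  have "(\<lambda>x. c *\<^sub>R f x + h x) differentiable_on S"
    using D assms(1) by (meson differentiableI differentiable_on_eq_differentiable_at)
  \<comment> \<open>The derivative of the combination is the combination of the derivatives only at
    points of \<open>S\<close>, so the induction hypothesis is applied to the latter and transported
    by \<open>Ck_on_cong\<close>.\<close>
  moreover have "Ck_on k (\<lambda>x. frechet_derivative (\<lambda>x. c *\<^sub>R f x + h x) (at x) v) S" for v
  proof (rule Ck_on_cong[OF assms(1)])
    show "Ck_on k (\<lambda>x. c *\<^sub>R frechet_derivative f (at x) v + frechet_derivative h (at x) v) S"
      using Suc by simp
  qed (simp add: frechet_derivative_at[OF D, symmetric])
  ultimately show ?case by simp
qed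

lemma Ck_on_subset: "Ck_on k f S \<Longrightarrow> T \<subseteq> S \<Longrightarrow> Ck_on k f T"
  by (induction k arbitrary: f) (auto intro: continuous_on_subset differentiable_on_subset)

text \<open>The shape \<open>a * v f + w f\<close> is the closure property used throughout; sums and
  differences are the cases 1 and -1 of the coefficient.\<close>

lemma linear_combination_tangent_space:
  assumes "v \<in> tangent_space M p" "w \<in> tangent_space M p"
  shows "(\<lambda>f. a * v f + w f) \<in> tangent_space M p"
proof -
  have "a * v f + w f = a * v h + w h" if "openin (mtop M) U" "p \<in> U" "\<forall>q\<in>U. f q = h q" for U f h
    using that assms unfolding tangent_space_def by (smt (verit) mem_Collect_eq)
  moreover have "\<forall>f. \<not> smooth_near M p f \<longrightarrow> a * v f + w f = 0"
    using assms unfolding tangent_space_def by simp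
  ultimately show ?thesis
    using assms unfolding tangent_space_def by (auto simp: algebra_simps)
qed

section \<open>Smooth functions and vector fields on open subsets\<close>

context smooth_manifold
begin

text \<open>Injectivity of the chart makes \<open>inv_into\<close> its genuine inverse, so that
  \<open>f \<circ> inv_into V \<phi>\<close> is the coordinate expression of
  \<open>f\<close>.\<close>

lemma chart_inv_into:
  assumes "(V, \<phi>) \<in> atlas M" "q \<in> V"
  shows "inv_into V \<phi> (\<phi> q) = q"
proof -
  have "V \<subseteq> topspace (mtop M)" using chart_domain[OF assms(1)] by (simp add: openin_subset)
  then have "inj_on \<phi> V"
    using chart_homeo[OF assms(1)] by (auto simp: homeomorphic_map_def Int_absorb1 dest: homeomorphic_imp_injective_map)
  then show ?thesis using assms(2) by simp
qed

lemma open_chart_image: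
  assumes "(V, \<phi>) \<in> atlas M" "openin (mtop M) U"
  shows "open (\<phi> ` (U \<inter> V))"
proof -
  have "openin (subtopology (mtop M) V) (U \<inter> V)"
    using assms(2) by (auto simp: openin_subtopology)
  then have "openin (top_of_set (\<phi> ` V)) (\<phi> ` (U \<inter> V))"
    using chart_homeo[OF assms(1)] by (meson homeomorphic_imp_open_map open_map_def)
  then show ?thesis
    using chart_range[OF assms(1)] by (meson openin_open_eq)
qed

lemma smooth_fun_cong:
  assumes "smooth_fun M U f" "\<And>q. q \<in> U \<Longrightarrow> f q = h q"
  shows "smooth_fun M U h"
  unfolding smooth_fun_def
proof (intro conjI ballI, unfold split_paired_all case_prod_conv)
  show o: "openin (mtop M) U" using assms(1) by (simp add: smooth_fun_def)
  fix V \<phi> assume V: "(V, \<phi>) \<in> atlas M"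
  show "smooth_on (h \<circ> inv_into V \<phi>) (\<phi> ` (U \<inter> V))"
    unfolding smooth_on_def
  proof (intro allI, rule Ck_on_cong[OF open_chart_image[OF V o]])
    show "Ck_on k (f \<circ> inv_into V \<phi>) (\<phi> ` (U \<inter> V))" for k
      using assms(1) V by (auto simp: smooth_fun_def smooth_on_def)
  qed (use assms(2) in \<open>auto simp: chart_inv_into[OF V]\<close>)
qed

lemma smooth_fun_linear_combination:
  assumes "smooth_fun M U f" "smooth_fun M U h"
  shows "smooth_fun M U (\<lambda>q. a * f q + h q)"
proof -
  have o: "openin (mtop M) U" using assms(1) by (simp add: smooth_fun_def)
  have "Ck_on k ((\<lambda>q. a * f q + h q) \<circ> inv_into V \<phi>) (\<phi> ` (U \<inter> V))"
    if V: "(V, \<phi>) \<in> atlas M" for V \<phi> k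
  proof -
    have "Ck_on k (f \<circ> inv_into V \<phi>) (\<phi> ` (U \<inter> V))" "Ck_on k (h \<circ> inv_into V \<phi>) (\<phi> ` (U \<inter> V))"
      using assms V by (auto simp: smooth_fun_def smooth_on_def)
    from Ck_on_linear_combination[OF open_chart_image[OF V o] this, of a] show ?thesis
      by (simp add: o_def)
  qed
  with o show ?thesis by (auto simp: smooth_fun_def smooth_on_def)
qed

lemma smooth_fun_subset:
  assumes "smooth_fun M U f" "W \<subseteq> U" "openin (mtop M) W"
  shows "smooth_fun M W f"
proof -
  have "Ck_on k (f \<circ> inv_into V \<phi>) (\<phi> ` (W \<inter> V))" if V: "(V, \<phi>) \<in> atlas M" for V \<phi> k
  proof (rule Ck_on_subset)
    show "Ck_on k (f \<circ> inv_into V \<phi>) (\<phi> ` (U \<inter> V))"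
      using assms(1) V by (auto simp: smooth_fun_def smooth_on_def)
  qed (use assms(2) in auto)
  with assms(3) show ?thesis by (auto simp: smooth_fun_def smooth_on_def)
qed

lemma smooth_fun_imp_smooth_near: "smooth_fun M U f \<Longrightarrow> q \<in> U \<Longrightarrow> smooth_near M q f"
  by (auto simp: smooth_near_def)

lemma vector_field_cong:
  assumes "vector_field M U X" "\<And>q. q \<in> U \<Longrightarrow> X q = Y q"
  shows "vector_field M U Y"
  using assms unfolding vector_field_def
  by (smt (verit) smooth_fun_cong subset_eq)

lemma vector_field_linear_combination:
  assumes "vector_field M U X" "vector_field M U Y"
  shows "vector_field M U (\<lambda>q f. a * X q f + Y q f)"
  using assms unfolding vector_field_def
  by (auto intro: linear_combination_tangent_space smooth_fun_linear_combination)

lemma vector_field_add: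
  "vector_field M U X \<Longrightarrow> vector_field M U Y \<Longrightarrow> vector_field M U (\<lambda>q f. X q f + Y q f)"
  using vector_field_linear_combination[of U X Y 1] by simp

lemma vector_field_diff:
  "vector_field M U X \<Longrightarrow> vector_field M U Y \<Longrightarrow> vector_field M U (\<lambda>q f. X q f - Y q f)"
  using vector_field_linear_combination[of U Y X "-1"] by simp

lemma vector_field_uminus: "vector_field M U X \<Longrightarrow> vector_field M U (\<lambda>q f. - X q f)"
  \<comment> \<open>Negation is obtained as -2 X + X = -X.\<close>
  using vector_field_linear_combination[of U X X "-2"] by simp

end

section \<open>Complex vector fields and connections\<close>

lemma tangent_linear:
  assumes "v \<in> tangent_space M p" "smooth_near M p f" "smooth_near M p h"
  shows "v (\<lambda>q. a * f q + h q) = a * v f + v h"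
  using assms by (simp add: tangent_space_def)

lemma tangent_add:
  assumes "v \<in> tangent_space M p" "smooth_near M p f" "smooth_near M p h"
  shows "v (\<lambda>q. f q + h q) = v f + v h"
  using tangent_linear[OF assms, of 1] by simp

lemma tangent_diff:
  assumes "v \<in> tangent_space M p" "smooth_near M p f" "smooth_near M p h"
  shows "v (\<lambda>q. f q - h q) = v f - v h"
  using tangent_linear[OF assms(1,3,2), of "-1"] by simp

lemma tangent_cong:
  assumes "v \<in> tangent_space M p" "openin (mtop M) U" "p \<in> U" "\<And>q. q \<in> U \<Longrightarrow> f q = h q"
  shows "v f = v h"
  using assms unfolding tangent_space_def by blast

lemma re_im_linear_combination:
  "re (\<lambda>f. c * v f + w f) = (\<lambda>f. Re c * re v f + ((- Im c) * im v f + re w f))"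
  "im (\<lambda>f. c * v f + w f) = (\<lambda>f. Im c * re v f + (Re c * im v f + im w f))"
  by (auto simp: re_def im_def algebra_simps)

lemma linear_combination_ctangent_space:
  assumes "v \<in> ctangent_space M p" "w \<in> ctangent_space M p"
  shows "(\<lambda>f. c * v f + w f) \<in> ctangent_space M p"
  using assms unfolding ctangent_space_def re_im_linear_combination mem_Collect_eq
  by (intro conjI linear_combination_tangent_space) auto

lemma cvector_field_ctangent: "cvector_field M U X \<Longrightarrow> q \<in> U \<Longrightarrow> X q \<in> ctangent_space M q"
  by (auto simp: cvector_field_def vector_field_def ctangent_space_def)

lemma cvector_field_openin: "cvector_field M U X \<Longrightarrow> openin (mtop M) U"
  by (auto simp: cvector_field_def vector_field_def)

text \<open>The complex bilinear extension of the action of vectors on functions. Elements of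
  \<open>ctvec\<close> act on real-valued functions only, so a complex-valued argument such as
  \<open>\<lambda>q. Y q f\<close> has to be split as well.\<close>

definition cderiv :: "'a ctvec \<Rightarrow> ('a \<Rightarrow> complex) \<Rightarrow> complex" where
  "cderiv v F = Complex (re v (\<lambda>q. Re (F q)) - im v (\<lambda>q. Im (F q)))
                        (re v (\<lambda>q. Im (F q)) + im v (\<lambda>q. Re (F q)))"

definition csmooth_fun :: "('a, 'e::euclidean_space) manifold \<Rightarrow> 'a set \<Rightarrow> ('a \<Rightarrow> complex) \<Rightarrow> bool" where
  "csmooth_fun M U F \<longleftrightarrow> smooth_fun M U (\<lambda>q. Re (F q)) \<and> smooth_fun M U (\<lambda>q. Im (F q))"

lemma cderiv_cong:
  assumes "v \<in> ctangent_space M p" "openin (mtop M) U" "p \<in> U" "\<And>q. q \<in> U \<Longrightarrow> F q = G q"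
  shows "cderiv v F = cderiv v G"
proof -
  have "w (\<lambda>q. Re (F q)) = w (\<lambda>q. Re (G q))" "w (\<lambda>q. Im (F q)) = w (\<lambda>q. Im (G q))"
    if "w \<in> tangent_space M p" for w
    by (rule tangent_cong[OF that assms(2,3)]; simp add: assms(4))+
  from this[of "re v"] this[of "im v"] show ?thesis
    using assms(1) by (simp add: cderiv_def ctangent_space_def)
qed

lemma cderiv_eq: "cderiv v F = v (\<lambda>q. Re (F q)) + \<i> * v (\<lambda>q. Im (F q))"
  by (simp add: cderiv_def re_def im_def complex_eq_iff)

lemma tangent_space_add: "v \<in> tangent_space M p \<Longrightarrow> w \<in> tangent_space M p \<Longrightarrow> (\<lambda>f. v f + w f) \<in> tangent_space M p"
  using linear_combination_tangent_space[of v M p w 1] by simp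

lemma tangent_space_diff: "v \<in> tangent_space M p \<Longrightarrow> w \<in> tangent_space M p \<Longrightarrow> (\<lambda>f. v f - w f) \<in> tangent_space M p"
  using linear_combination_tangent_space[of w M p v "-1"] by simp

context smooth_manifold
begin

lemma csmooth_fun_linear_combination:
  assumes "csmooth_fun M U F" "csmooth_fun M U G"
  shows "csmooth_fun M U (\<lambda>q. c * F q + G q)"
proof -
  have "smooth_fun M U (\<lambda>q. Re c * Re (F q) + ((- Im c) * Im (F q) + Re (G q)))"
    "smooth_fun M U (\<lambda>q. Im c * Re (F q) + (Re c * Im (F q) + Im (G q)))"
    using assms by (auto simp only: csmooth_fun_def intro!: smooth_fun_linear_combination)
  then show ?thesis by (simp add: csmooth_fun_def algebra_simps)
qed

lemma cderiv_linear:
  assumes "v \<in> ctangent_space M p" "csmooth_fun M U F" "csmooth_fun M U G" "p \<in> U"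
  shows "cderiv v (\<lambda>q. c * F q + G q) = c * cderiv v F + cderiv v G"
proof -
  have t: "re v \<in> tangent_space M p" "im v \<in> tangent_space M p"
    using assms(1) by (auto simp: ctangent_space_def)
  \<comment> \<open>Real and imaginary parts of c F + G are combinations of three real functions, so
    one three-term rule serves all four real derivatives.\<close>
  have l: "w (\<lambda>q. a * f q + (b * h q + k q)) = a * w f + (b * w h + w k)"
    if "w \<in> tangent_space M p" "smooth_fun M U f" "smooth_fun M U h" "smooth_fun M U k" for w a b f h k
  proof -
    note near = smooth_fun_imp_smooth_near[OF _ assms(4)]
    show ?thesis
      using tangent_linear[OF that(1) near[OF that(2)] near[OF smooth_fun_linear_combination[OF that(3,4)]]]
        tangent_linear[OF that(1) near[OF that(3)] near[OF that(4)]]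
      by simp
  qed
  have e: "Re (c * F q + G q) = Re c * Re (F q) + ((- Im c) * Im (F q) + Re (G q))"
    "Im (c * F q + G q) = Im c * Re (F q) + (Re c * Im (F q) + Im (G q))" for q
    by simp_all
  note s = assms(2,3)[unfolded csmooth_fun_def]
  have "cderiv v (\<lambda>q. c * F q + G q) = Complex
     ((Re c * re v (\<lambda>q. Re (F q)) + ((- Im c) * re v (\<lambda>q. Im (F q)) + re v (\<lambda>q. Re (G q))))
     - (Im c * im v (\<lambda>q. Re (F q)) + (Re c * im v (\<lambda>q. Im (F q)) + im v (\<lambda>q. Im (G q)))))
     ((Im c * re v (\<lambda>q. Re (F q)) + (Re c * re v (\<lambda>q. Im (F q)) + re v (\<lambda>q. Im (G q))))
     + (Re c * im v (\<lambda>q. Re (F q)) + ((- Im c) * im v (\<lambda>q. Im (F q)) + im v (\<lambda>q. Re (G q)))))"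
    unfolding cderiv_def e
    using s by (simp only: l[OF t(1)] l[OF t(2)])
  then show ?thesis
    by (simp add: cderiv_def complex_eq_iff algebra_simps)
qed

lemma cderiv_diff:
  assumes "v \<in> ctangent_space M p" "csmooth_fun M U F" "csmooth_fun M U G" "p \<in> U"
  shows "cderiv v (\<lambda>q. F q - G q) = cderiv v F - cderiv v G"
  using cderiv_linear[OF assms(1,3,2,4), of "-1"] by simp

lemma cderiv_uminus:
  assumes "v \<in> ctangent_space M p" "csmooth_fun M U F" "p \<in> U"
  shows "cderiv v (\<lambda>q. - F q) = - cderiv v F"
  using cderiv_linear[OF assms(1,2,2,3), of "-2"] by simp

lemma cvector_field_cong:
  assumes "cvector_field M U X" "\<And>q. q \<in> U \<Longrightarrow> X q = Y q"
  shows "cvector_field M U Y"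
  unfolding cvector_field_def
proof
  show "vector_field M U (\<lambda>p. re (Y p))"
    by (rule vector_field_cong[of U "\<lambda>p. re (X p)"]) (use assms in \<open>auto simp: cvector_field_def\<close>)
  show "vector_field M U (\<lambda>p. im (Y p))"
    by (rule vector_field_cong[of U "\<lambda>p. im (X p)"]) (use assms in \<open>auto simp: cvector_field_def\<close>)
qed

lemma cvector_field_diff:
  assumes "cvector_field M U X" "cvector_field M U Y"
  shows "cvector_field M U (\<lambda>q f. X q f - Y q f)"
  using vector_field_diff assms unfolding cvector_field_def by (simp add: re_def im_def)

lemma cvector_field_conj_field:
  assumes "cvector_field M U X"
  shows "cvector_field M U (conj_field X)"
  using vector_field_uminus assms unfolding cvector_field_def conj_field_def by (simp add: re_def im_def)

lemma csmooth_fun_apply: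
  assumes "cvector_field M U X" "csmooth_fun M W F" "W \<subseteq> U"
  shows "csmooth_fun M W (\<lambda>q. cderiv (X q) F)"
  using assms unfolding csmooth_fun_def cderiv_def cvector_field_def vector_field_def complex.sel
  using smooth_fun_linear_combination[of W _ _ 1] smooth_fun_linear_combination[of W _ _ "-1"]
  by simp

section \<open>The complex Lie bracket and the Jacobi identity\<close>

lemma clie_bracket_apply:
  "clie_bracket M X Y p f = (if smooth_near M p f
     then cderiv (X p) (\<lambda>q. Y q f) - cderiv (Y p) (\<lambda>q. X q f) else 0)"
  by (simp add: clie_bracket_def cbilinear_def lie_bracket_def cderiv_def re_def im_def complex_eq_iff)

text \<open>Applied to a function, each double bracket becomes four iterated derivatives, and the
  twelve cancel in pairs. That the inner brackets are smooth fields enters as a hypothesis;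
  \<open>cvector_field_clie_bracket\<close> supplies it later with the help of
  \<open>D\<close>.\<close>

lemma clie_bracket_jacobi:
  assumes "cvector_field M U X" "cvector_field M U Y" "cvector_field M U Z" "p \<in> U"
    "cvector_field M U (clie_bracket M X Y)" "cvector_field M U (clie_bracket M Y Z)"
    "cvector_field M U (clie_bracket M Z X)"
  shows "clie_bracket M (clie_bracket M X Y) Z p f + clie_bracket M (clie_bracket M Y Z) X p f
    + clie_bracket M (clie_bracket M Z X) Y p f = 0"
proof (cases "smooth_near M p f")
  case True
  then obtain W0 where W0: "p \<in> W0" "smooth_fun M W0 f" by (auto simp: smooth_near_def)
  \<comment> \<open>On \<open>W\<close> the function is smooth at every point and all fields are
    defined, so the commutator formula can be differentiated at \<open>p\<close> and not merely
    evaluated there.\<close>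
  define W where "W = W0 \<inter> U"
  have W: "p \<in> W" "W \<subseteq> U" "openin (mtop M) W"
    using W0 assms(4) cvector_field_openin[OF assms(1)] by (auto simp: W_def smooth_fun_def)
  have sf: "smooth_fun M W f" using smooth_fun_subset[OF W0(2) _ W(3)] by (simp add: W_def)
  then have near: "smooth_near M q f" if "q \<in> W" for q using that by (rule smooth_fun_imp_smooth_near)
  have s1: "csmooth_fun M W (\<lambda>q. V q f)" if "cvector_field M U V" for V
    using that sf W(2) by (simp add: csmooth_fun_def cvector_field_def vector_field_def re_def im_def)
  have s2: "csmooth_fun M W (\<lambda>q. cderiv (V' q) (\<lambda>q. V q f))" if "cvector_field M U V" "cvector_field M U V'" for V V'
    using csmooth_fun_apply[OF that(2) s1[OF that(1)] W(2)] .
  have b: "cderiv (V'' p) (\<lambda>q. clie_bracket M V V' q f)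
      = cderiv (V'' p) (\<lambda>q. cderiv (V q) (\<lambda>q. V' q f)) - cderiv (V'' p) (\<lambda>q. cderiv (V' q) (\<lambda>q. V q f))"
    if V: "cvector_field M U V" "cvector_field M U V'" "cvector_field M U V''" for V V' V''
  proof -
    note t = cvector_field_ctangent[OF V(3) assms(4)]
    have "cderiv (V'' p) (\<lambda>q. clie_bracket M V V' q f)
       = cderiv (V'' p) (\<lambda>q. cderiv (V q) (\<lambda>q. V' q f) - cderiv (V' q) (\<lambda>q. V q f))"
      by (rule cderiv_cong[OF t W(3,1)]) (simp add: clie_bracket_apply near)
    also have "\<dots> = cderiv (V'' p) (\<lambda>q. cderiv (V q) (\<lambda>q. V' q f)) - cderiv (V'' p) (\<lambda>q. cderiv (V' q) (\<lambda>q. V q f))"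
      by (rule cderiv_diff[OF t _ _ W(1)]) (auto intro!: s2 V)
    finally show ?thesis .
  qed
  \<comment> \<open>Here the outer bracket acts on the complex-valued function
    \<open>\<lambda>q. V'' q f\<close>. It is split by \<open>cderiv_eq\<close>, since the
    commutator formula speaks of real functions.\<close>
  have c: "cderiv (clie_bracket M V V' p) (\<lambda>q. V'' q f)
      = cderiv (V p) (\<lambda>q. cderiv (V' q) (\<lambda>q. V'' q f)) - cderiv (V' p) (\<lambda>q. cderiv (V q) (\<lambda>q. V'' q f))"
    if V: "cvector_field M U V" "cvector_field M U V'" "cvector_field M U V''" for V V' V''
  proof -
    define F where "F = (\<lambda>q. V'' q f)"
    have F: "smooth_fun M W (\<lambda>q. Re (F q))" "smooth_fun M W (\<lambda>q. Im (F q))"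
      using s1[OF V(3)] by (auto simp: csmooth_fun_def F_def)
    have s: "csmooth_fun M W (\<lambda>q. N q h)" if "cvector_field M U N" "smooth_fun M W h" for N h
      using that W(2) by (simp add: csmooth_fun_def cvector_field_def vector_field_def re_def im_def)
    have l: "cderiv (N p) (\<lambda>q. cderiv (N' q) F) = \<i> * cderiv (N p) (\<lambda>q. N' q (\<lambda>q. Im (F q)))
        + cderiv (N p) (\<lambda>q. N' q (\<lambda>q. Re (F q)))" if "cvector_field M U N" "cvector_field M U N'" for N N'
      using cderiv_linear[OF cvector_field_ctangent[OF that(1) assms(4)] s[OF that(2) F(2)] s[OF that(2) F(1)] W(1), of \<i>]
      by (simp add: cderiv_eq[of _ F] add.commute)
    have "cderiv (clie_bracket M V V' p) F = clie_bracket M V V' p (\<lambda>q. Re (F q))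
        + \<i> * clie_bracket M V V' p (\<lambda>q. Im (F q))"
      by (rule cderiv_eq)
    also have "\<dots> = cderiv (V p) (\<lambda>q. cderiv (V' q) F) - cderiv (V' p) (\<lambda>q. cderiv (V q) F)"
      using F W(1) by (simp add: clie_bracket_apply smooth_fun_imp_smooth_near l V algebra_simps)
    finally show ?thesis by (simp add: F_def)
  qed
  show ?thesis
    using True b c assms by (simp add: clie_bracket_apply[of "clie_bracket M _ _"])
next
  case False
  then show ?thesis by (simp add: clie_bracket_apply)
qed

end

section \<open>Complex extension of a single connection\<close>

locale manifold_connection = smooth_manifold M + connection M nab
  for M :: "('a, 'e::euclidean_space) manifold" and nab
begin

lemma nab_uminus:
  assumes "vector_field M U Y" "p \<in> U" "v \<in> tangent_space M p"
  shows "nab p v (\<lambda>q f. - Y q f) = (\<lambda>f. - nab p v Y f)"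
proof -
  \<comment> \<open>Additivity at 0 + 0 shows that the zero field has derivative 0; additivity at Y
    + (-Y) then gives the sign rule.\<close>
  have z: "vector_field M U (\<lambda>q f. 0)" using vector_field_diff[OF assms(1,1)] by simp
  have "nab p v (\<lambda>q f. 0) f = 0" for f
    using fun_cong[OF additive[OF z z assms(2,3)], of f] by simp
  moreover have "nab p v (\<lambda>q f. 0) f = nab p v Y f + nab p v (\<lambda>q f. - Y q f) f" for f
    using fun_cong[OF additive[OF assms(1) vector_field_uminus[OF assms(1)] assms(2,3)], of f] by simp
  ultimately show ?thesis by (auto simp: eq_neg_iff_add_eq_0 add.commute)
qed

lemma nab_diff:
  assumes "vector_field M U Y" "vector_field M U Z" "p \<in> U" "v \<in> tangent_space M p"
  shows "nab p v (\<lambda>q f. Y q f - Z q f) = (\<lambda>f. nab p v Y f - nab p v Z f)"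
  using additive[OF assms(1) vector_field_uminus[OF assms(2)] assms(3,4)] nab_uminus[OF assms(2-4)] by simp

lemma re_im_cnabla:
  "re (cnabla nab X Y p) = (\<lambda>f. nab p (re (X p)) (\<lambda>q. re (Y q)) f - nab p (im (X p)) (\<lambda>q. im (Y q)) f)"
  "im (cnabla nab X Y p) = (\<lambda>f. nab p (re (X p)) (\<lambda>q. im (Y q)) f + nab p (im (X p)) (\<lambda>q. re (Y q)) f)"
  by (simp_all add: cnabla_def cbilinear_def re_def im_def)

lemma cvector_field_cnabla:
  assumes "cvector_field M U X" "cvector_field M U Y"
  shows "cvector_field M U (cnabla nab X Y)"
  using assms unfolding cvector_field_def re_im_cnabla
  by (auto intro!: vector_field_diff vector_field_add smooth)

lemma cnabla_diff:
  assumes "cvector_field M U X" "cvector_field M U Y" "cvector_field M U Z" "p \<in> U"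
  shows "cnabla nab X (\<lambda>q f. Y q f - Z q f) p = (\<lambda>f. cnabla nab X Y p f - cnabla nab X Z p f)"
proof -
  note X = cvector_field_ctangent[OF assms(1,4)]
  have [simp]: "re (\<lambda>f. Y q f - Z q f) = (\<lambda>f. re (Y q) f - re (Z q) f)"
     "im (\<lambda>f. Y q f - Z q f) = (\<lambda>f. im (Y q) f - im (Z q) f)" for q
    by (simp_all add: re_def im_def)
  show ?thesis
    using X assms nab_diff unfolding cnabla_def cbilinear_def cvector_field_def ctangent_space_def
    by (auto simp: fun_eq_iff complex_eq_iff)
qed

text \<open>The scalar \<open>\<i>\<close> is the one by which \<open>cJ\<close> acts on type (1,0),
  so this serves to show that nabla preserves that type. It exchanges real and imaginary parts up to
  a sign, which \<open>nab_uminus\<close> handles.\<close>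

lemma cnabla_ii:
  assumes "cvector_field M U X" "cvector_field M U Y" "p \<in> U"
  shows "cnabla nab X (\<lambda>q f. \<i> * Y q f) p = (\<lambda>f. \<i> * cnabla nab X Y p f)"
proof -
  note X = cvector_field_ctangent[OF assms(1,3)]
  have [simp]: "re (\<lambda>f. \<i> * Y q f) = (\<lambda>f. - im (Y q) f)" "im (\<lambda>f. \<i> * Y q f) = re (Y q)" for q
    by (simp_all add: re_def im_def)
  show ?thesis
    using X assms nab_uminus unfolding cnabla_def cbilinear_def cvector_field_def ctangent_space_def
    by (auto simp: fun_eq_iff complex_eq_iff)
qed

lemma cnabla_cong:
  assumes "cvector_field M U X" "cvector_field M U Y" "p \<in> U" "\<And>q. q \<in> U \<Longrightarrow> Y q = Z q"
  shows "cnabla nab X Y p = cnabla nab X Z p"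
proof -
  note c = cvector_field_cong[OF assms(2,4)]
  have "nab p v (\<lambda>q. re (Y q)) = nab p v (\<lambda>q. re (Z q))"
    "nab p v (\<lambda>q. im (Y q)) = nab p v (\<lambda>q. im (Z q))" if "v \<in> tangent_space M p" for v
    using assms c that unfolding cvector_field_def by (auto intro!: local[of U])
  then show ?thesis
    using cvector_field_ctangent[OF assms(1,3)]
    unfolding cnabla_def cbilinear_def ctangent_space_def by simp
qed

text \<open>The direction is constrained at \<open>p\<close> alone, so that \<open>X\<close> may be
  a constant family \<open>\<lambda>_. v\<close> standing for a single complex vector at
  \<open>p\<close>.\<close>

lemma cnabla_ctangent:
  assumes "cvector_field M U Y" "p \<in> U" "X p \<in> ctangent_space M p"
  shows "cnabla nab X Y p \<in> ctangent_space M p"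
proof -
  have "nab p v (\<lambda>q. re (Y q)) \<in> tangent_space M p" "nab p v (\<lambda>q. im (Y q)) \<in> tangent_space M p"
    if "v \<in> tangent_space M p" for v
    using assms that closed[OF _ assms(2)] by (auto simp: cvector_field_def)
  then show ?thesis
    using assms(3) unfolding ctangent_space_def mem_Collect_eq re_im_cnabla
    by (auto intro: tangent_space_add tangent_space_diff)
qed

lemma cnabla_linear:
  assumes "cvector_field M U Y" "p \<in> U" "v \<in> ctangent_space M p" "w \<in> ctangent_space M p"
    and "X p = (\<lambda>f. c * v f + w f)"
  shows "cnabla nab X Y p = (\<lambda>f. c * cnabla nab (\<lambda>_. v) Y p f + cnabla nab (\<lambda>_. w) Y p f)"
proof -
  have y: "vector_field M U (\<lambda>q. re (Y q))" "vector_field M U (\<lambda>q. im (Y q))"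
    using assms(1) by (auto simp: cvector_field_def)
  have l: "nab p (\<lambda>f. a * re v f + (b * im v f + u f)) Z
      = (\<lambda>f. a * nab p (re v) Z f + (b * nab p (im v) Z f + nab p u Z f))"
    if "vector_field M U Z" "u \<in> tangent_space M p" for a b u Z
    using assms(3) that by (simp add: ctangent_space_def linear[OF _ assms(2)] linear_combination_tangent_space)
  have u: "re w \<in> tangent_space M p" "im w \<in> tangent_space M p"
    using assms(4) by (auto simp: ctangent_space_def)
  show ?thesis
    unfolding cnabla_def cbilinear_def assms(5) re_im_linear_combination
    by (simp only: l[OF y(1) u(1)] l[OF y(1) u(2)] l[OF y(2) u(1)] l[OF y(2) u(2)])
      (simp add: fun_eq_iff complex_eq_iff algebra_simps)
qed

end

section \<open>Metric connections\<close>

lemma ctangent_add: "v \<in> ctangent_space M p \<Longrightarrow> w \<in> ctangent_space M p \<Longrightarrow> (\<lambda>f. v f + w f) \<in> ctangent_space M p"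
  using linear_combination_ctangent_space[of v M p w 1] by simp

lemma ctangent_diff: "v \<in> ctangent_space M p \<Longrightarrow> w \<in> ctangent_space M p \<Longrightarrow> (\<lambda>f. v f - w f) \<in> ctangent_space M p"
  using linear_combination_ctangent_space[of w M p v "-1"] by simp

context almost_hermitian_manifold
begin

lemma cmetric_linear:
  assumes "p \<in> topspace (mtop M)" "v \<in> ctangent_space M p" "w \<in> ctangent_space M p" "z \<in> ctangent_space M p"
  shows "cmetric g p (\<lambda>f. c * v f + w f) z = c * cmetric g p v z + cmetric g p w z"
proof -
  have l: "g p (\<lambda>f. a * re v f + (b * im v f + u f)) x = a * g p (re v) x + (b * g p (im v) x + g p u x)"
    if "u \<in> tangent_space M p" "x \<in> tangent_space M p" for a b u x
    using assms that by (simp add: ctangent_space_def g_linear linear_combination_tangent_space)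
  have t: "re w \<in> tangent_space M p" "im w \<in> tangent_space M p" "re z \<in> tangent_space M p" "im z \<in> tangent_space M p"
    using assms by (auto simp: ctangent_space_def)
  show ?thesis
    unfolding cmetric_def re_im_linear_combination
    by (simp only: l[OF t(1) t(3)] l[OF t(1) t(4)] l[OF t(2) t(3)] l[OF t(2) t(4)])
      (simp add: complex_eq_iff algebra_simps)
qed

lemma cmetric_add:
  assumes "p \<in> topspace (mtop M)" "v \<in> ctangent_space M p" "w \<in> ctangent_space M p" "z \<in> ctangent_space M p"
  shows "cmetric g p (\<lambda>f. v f + w f) z = cmetric g p v z + cmetric g p w z"
  using cmetric_linear[OF assms, of 1] by simp

lemma cmetric_diff:
  assumes "p \<in> topspace (mtop M)" "v \<in> ctangent_space M p" "w \<in> ctangent_space M p" "z \<in> ctangent_space M p"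
  shows "cmetric g p (\<lambda>f. v f - w f) z = cmetric g p v z - cmetric g p w z"
  using cmetric_linear[OF assms(1,3,2,4), of "-1"] by simp

lemma cmetric_commute:
  assumes "p \<in> topspace (mtop M)" "v \<in> ctangent_space M p" "w \<in> ctangent_space M p"
  shows "cmetric g p v w = cmetric g p w v"
  using assms g_sym by (simp add: cmetric_def ctangent_space_def)

lemma csmooth_fun_cmetric:
  assumes "cvector_field M U X" "cvector_field M U Y"
  shows "csmooth_fun M U (\<lambda>q. cmetric g q (X q) (Y q))"
proof -
  have s: "smooth_fun M U (\<lambda>q. g q (x (X q)) (y (Y q)))" if "x \<in> {re, im}" "y \<in> {re, im}" for x y
    using assms that by (auto simp: cvector_field_def intro: g_smooth)
  show ?thesis
    using smooth_fun_linear_combination[OF s s, of im im re re "-1"]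
      smooth_fun_linear_combination[OF s s, of re im im re 1]
    by (simp add: csmooth_fun_def cmetric_def)
qed

text \<open>Compatibility of g with J gives <v, w> = <Jv, Jw> = <iv, iw> = -<v, w>. In real terms,
  type (1,0) means that J sends the real part to minus the imaginary part and the imaginary part to
  the real part.\<close>

lemma cmetric_T10:
  assumes "p \<in> topspace (mtop M)" "v \<in> T10 M J p" "w \<in> T10 M J p"
  shows "cmetric g p v w = 0"
proof -
  have t: "v \<in> ctangent_space M p" "w \<in> ctangent_space M p"
    using assms by (auto simp: T10_def)
  have J: "J p (re x) = (\<lambda>f. - im x f)" "J p (im x) = re x" if "x \<in> T10 M J p" for x
    using that by (auto simp: T10_def cJ_def re_def im_def fun_eq_iff complex_eq_iff)
  have h: "g p (J p x) (J p y) = g p x y" if "x \<in> {re v, im v}" "y \<in> {re w, im w}" for x y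
    using that t hermitian[OF assms(1)] by (auto simp: ctangent_space_def)
  have m: "g p (\<lambda>f. - x f) y = - g p x y" if "x \<in> tangent_space M p" "y \<in> tangent_space M p" for x y
    using g_linear[OF assms(1) that(1) that(1) that(2), of "-2"] by simp
  have "g p (re v) (re w) = g p (im v) (im w)" "g p (re v) (im w) = - g p (im v) (re w)"
    using h[of "im v" "im w"] h[of "im v" "re w"] m[of "im w" "re v"] t assms(1)
      g_sym[OF assms(1), of "re v" "\<lambda>f. - im w f"] g_sym[OF assms(1), of "re v" "im w"]
      linear_combination_tangent_space[of "im w" M p "im w" "-2"]
      m[of "im v" "re w"] h[of "re v" "im w"]
    by (simp_all add: J[OF assms(2)] J[OF assms(3)] ctangent_space_def)
  then show ?thesis by (simp add: cmetric_def complex_eq_iff)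
qed

lemma field_topspace: "cvector_field M U X \<Longrightarrow> q \<in> U \<Longrightarrow> q \<in> topspace (mtop M)"
  using openin_subset[OF cvector_field_openin] by blast

end

section \<open>Metric compatibility in complex form\<close>

locale metric_connection = almost_hermitian_manifold n M J g + manifold_connection M nab
  for n and M :: "('a, 'e::euclidean_space) manifold" and J g nab +
  assumes metric_parallel: "metric_parallel M g nab"
begin

text \<open>The real product rule is applied to the four pairings of real and imaginary parts of
  \<open>Y\<close> and \<open>Z\<close>, in the directions of the real and of the imaginary part of
  \<open>X p\<close>.\<close>

lemma cmetric_compat:
  assumes "cvector_field M U X" "cvector_field M U Y" "cvector_field M U Z" "p \<in> U"
  shows "cderiv (X p) (\<lambda>q. cmetric g q (Y q) (Z q))
    = cmetric g p (cnabla nab X Y p) (Z p) + cmetric g p (Y p) (cnabla nab X Z p)"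
proof -
  note top = field_topspace[OF assms(1,4)]
  have x: "re (X p) \<in> tangent_space M p" "im (X p) \<in> tangent_space M p"
    using cvector_field_ctangent[OF assms(1,4)] by (auto simp: ctangent_space_def)
  have y: "vector_field M U (\<lambda>q. re (Y q))" "vector_field M U (\<lambda>q. im (Y q))"
    and z: "vector_field M U (\<lambda>q. re (Z q))" "vector_field M U (\<lambda>q. im (Z q))"
    using assms(2,3) by (auto simp: cvector_field_def)
  have t: "V p \<in> tangent_space M p" if "vector_field M U V" for V
    using that assms(4) by (auto simp: vector_field_def)
  have c: "v (\<lambda>q. g q (V q) (W q)) = g p (nab p v V) (W p) + g p (V p) (nab p v W)"
    if "vector_field M U V" "vector_field M U W" "v \<in> tangent_space M p" for v V W
  proof -
    have "v (\<lambda>q. g q (V q) (W q)) - g p (nab p v V) (W p) - g p (V p) (nab p v W) = 0"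
      using metric_parallel assms(4) that unfolding metric_parallel_def by blast
    then show ?thesis by simp
  qed
  have near: "smooth_near M p (\<lambda>q. g q (V q) (W q))" if "vector_field M U V" "vector_field M U W" for V W
    using g_smooth[OF that] assms(4) by (rule smooth_fun_imp_smooth_near)
  have ga: "g p (\<lambda>f. u f + v f) w = g p u w + g p v w" "g p (\<lambda>f. u f - v f) w = g p u w - g p v w"
    if "u \<in> tangent_space M p" "v \<in> tangent_space M p" "w \<in> tangent_space M p" for u v w
    using g_linear[OF top that, of 1] g_linear[OF top that(2,1,3), of "-1"] by simp_all
  have gb: "g p w (\<lambda>f. u f + v f) = g p w u + g p w v" "g p w (\<lambda>f. u f - v f) = g p w u - g p w v"
    if "u \<in> tangent_space M p" "v \<in> tangent_space M p" "w \<in> tangent_space M p" for u v w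
    using g_sym[OF top that(3)] ga[OF that] tangent_space_add[OF that(1,2)] tangent_space_diff[OF that(1,2)] that by simp_all
  note cl = closed[OF y(1) assms(4)] closed[OF y(2) assms(4)] closed[OF z(1) assms(4)] closed[OF z(2) assms(4)]
  note yz = t[OF y(1)] t[OF y(2)] t[OF z(1)] t[OF z(2)]
  note cl' = cl[OF x(1)] cl[OF x(2)]
  note n = near[OF y(1) z(1)] near[OF y(2) z(2)] near[OF y(1) z(2)] near[OF y(2) z(1)]
  have v: "v (\<lambda>q. g q (re (Y q)) (re (Z q)) - g q (im (Y q)) (im (Z q)))
      = g p (nab p v (\<lambda>q. re (Y q))) (re (Z p)) + g p (re (Y p)) (nab p v (\<lambda>q. re (Z q)))
      - (g p (nab p v (\<lambda>q. im (Y q))) (im (Z p)) + g p (im (Y p)) (nab p v (\<lambda>q. im (Z q))))"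
    "v (\<lambda>q. g q (re (Y q)) (im (Z q)) + g q (im (Y q)) (re (Z q)))
      = g p (nab p v (\<lambda>q. re (Y q))) (im (Z p)) + g p (re (Y p)) (nab p v (\<lambda>q. im (Z q)))
      + (g p (nab p v (\<lambda>q. im (Y q))) (re (Z p)) + g p (im (Y p)) (nab p v (\<lambda>q. re (Z q))))"
    if v: "v \<in> tangent_space M p" for v
    unfolding tangent_diff[OF v n(1,2)] tangent_add[OF v n(3,4)]
      c[OF y(1) z(1) v] c[OF y(2) z(2) v] c[OF y(1) z(2) v] c[OF y(2) z(1) v] by (rule refl)+
  show ?thesis
    unfolding cderiv_def cmetric_def complex.sel re_im_cnabla v[OF x(1)] v[OF x(2)]
    by (simp add: ga gb cl' yz complex_eq_iff)
qed

end

section \<open>The difference of the two connections\<close>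

locale canonical_and_levi_civita =
  LC: metric_connection n M J g D + CC: metric_connection n M J g nab
  for n and M :: "('a, 'e::euclidean_space) manifold" and J g D nab +
  assumes torsion_free: "\<lbrakk>vector_field M U X; vector_field M U Y; p \<in> U\<rbrakk> \<Longrightarrow> torsion M D X Y p = (\<lambda>f. 0)"
    and J_parallel: "J_parallel M J nab"
    and torsion_mixed: "\<lbrakk>T10_field M J U V; T10_field M J U W; p \<in> U\<rbrakk> \<Longrightarrow>
        ctorsion M nab V (conj_field W) p = (\<lambda>f. 0)"
begin

text \<open>Since J is parallel, J(nabla_X Y) = nabla_X (JY) = nabla_X (iY) = i nabla_X Y. The
  middle equality uses locality, because JY = iY is known only on \<open>U\<close>.\<close>

lemma T10_field_cnabla:
  assumes "cvector_field M U X" "T10_field M J U Y"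
  shows "T10_field M J U (cnabla nab X Y)"
proof -
  have Y: "cvector_field M U Y" using assms by (simp add: T10_field_def)
  note y = Y[unfolded cvector_field_def]
  have "cJ J p (cnabla nab X Y p) = (\<lambda>f. \<i> * cnabla nab X Y p f)" if p: "p \<in> U" for p
  proof -
    note top = LC.field_topspace[OF Y p] and Xp = cvector_field_ctangent[OF assms(1) p]
    have x: "re (X p) \<in> tangent_space M p" "im (X p) \<in> tangent_space M p"
      using Xp by (auto simp: ctangent_space_def)
    have JY: "cvector_field M U (\<lambda>q. cJ J q (Y q))"
      using y LC.J_smooth unfolding cvector_field_def cJ_def re_def im_def by simp
    have par: "J p (nab p v V) = nab p v (\<lambda>q. J q (V q))" if "vector_field M U V" "v \<in> tangent_space M p" for v V
    proof -
      have "(\<lambda>f. nab p v (\<lambda>q. J q (V q)) f - J p (nab p v V) f) = (\<lambda>f. 0)"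
        using J_parallel that p by (auto simp: J_parallel_def)
      then show ?thesis by (simp add: fun_eq_iff)
    qed
    have Jl: "J p (\<lambda>f. u f + v f) = (\<lambda>f. J p u f + J p v f)" "J p (\<lambda>f. u f - v f) = (\<lambda>f. J p u f - J p v f)"
      if "u \<in> tangent_space M p" "v \<in> tangent_space M p" for u v
      using LC.J_linear[OF top that, of 1] LC.J_linear[OF top that(2,1), of "-1"] by simp_all
    have cl: "nab p v V \<in> tangent_space M p" if "vector_field M U V" "v \<in> tangent_space M p" for v V
      using CC.closed[OF that(1) p that(2)] .
    have reim: "re (cJ J q v) = J q (re v)" "im (cJ J q v) = J q (im v)" for q v
      by (simp_all add: cJ_def re_def im_def)
    have "cJ J p (cnabla nab X Y p) = cnabla nab X (\<lambda>q. cJ J q (Y q)) p"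
      unfolding cnabla_def[of nab X "\<lambda>q. cJ J q (Y q)"] cbilinear_def reim
      unfolding cJ_def CC.re_im_cnabla
      using x y cl[OF _ x(1)] cl[OF _ x(2)] by (simp add: Jl par)
    also have "\<dots> = cnabla nab X (\<lambda>q f. \<i> * Y q f) p"
      by (rule CC.cnabla_cong[OF assms(1) JY p]) (use assms(2) in \<open>auto simp: T10_field_def T10_def\<close>)
    also have "\<dots> = (\<lambda>f. \<i> * cnabla nab X Y p f)"
      by (rule CC.cnabla_ii[OF assms(1) Y p])
    finally show ?thesis .
  qed
  then show ?thesis
    using CC.cvector_field_cnabla[OF assms(1) Y] cvector_field_ctangent
    by (fastforce simp: T10_field_def T10_def)
qed

lemma clie_bracket_eq:
  assumes "cvector_field M U X" "cvector_field M U Y" "q \<in> U"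
  shows "clie_bracket M X Y q = (\<lambda>f. cnabla D X Y q f - cnabla D Y X q f)"
proof -
  have "lie_bracket M V W q f = D q (V q) W f - D q (W q) V f"
    if "vector_field M U V" "vector_field M U W" for V W f
    using fun_cong[OF torsion_free[OF that assms(3)], of f] by (simp add: torsion_def)
  then show ?thesis
    using assms(1,2)
    by (simp add: clie_bracket_def cnabla_def cbilinear_def cvector_field_def fun_eq_iff complex_eq_iff)
qed

text \<open>Smoothness of the bracket is read off from the torsion-free connection: on
  \<open>U\<close> the bracket equals D_X Y - D_Y X.\<close>

lemma cvector_field_clie_bracket:
  assumes "cvector_field M U X" "cvector_field M U Y"
  shows "cvector_field M U (clie_bracket M X Y)"
  by (rule LC.cvector_field_cong[OF LC.cvector_field_diff[OF
        LC.cvector_field_cnabla[OF assms] LC.cvector_field_cnabla[OF assms(2,1)]]])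
    (simp add: clie_bracket_eq[OF assms])

lemma ctorsion_eq:
  "ctorsion M nab X Y = (\<lambda>q f. cnabla nab X Y q f - cnabla nab Y X q f - clie_bracket M X Y q f)"
  by (simp add: ctorsion_def cnabla_def clie_bracket_def torsion_def cbilinear_def fun_eq_iff complex_eq_iff)

lemma ctorsion_swap: "ctorsion M nab X Y p f = - ctorsion M nab Y X p f"
  by (simp add: ctorsion_eq LC.clie_bracket_apply)

lemma cvector_field_ctorsion:
  assumes "cvector_field M U X" "cvector_field M U Y"
  shows "cvector_field M U (ctorsion M nab X Y)"
  unfolding ctorsion_eq
  using assms by (intro LC.cvector_field_diff CC.cvector_field_cnabla cvector_field_clie_bracket)

text \<open>\<open>conn_diff\<close> is the tensor A of the introduction and \<open>cdiff3\<close>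
  is S. Both take fields as arguments, since a connection differentiates its second
  argument.\<close>

definition conn_diff :: "('a \<Rightarrow> 'a ctvec) \<Rightarrow> ('a \<Rightarrow> 'a ctvec) \<Rightarrow> 'a \<Rightarrow> 'a ctvec" where
  "conn_diff X Y q = (\<lambda>f. cnabla D X Y q f - cnabla nab X Y q f)"

definition cdiff3 :: "('a \<Rightarrow> 'a ctvec) \<Rightarrow> ('a \<Rightarrow> 'a ctvec) \<Rightarrow> ('a \<Rightarrow> 'a ctvec) \<Rightarrow> 'a \<Rightarrow> complex" where
  "cdiff3 X Y Z q = cmetric g q (conn_diff X Y q) (Z q)"

lemma cvector_field_conn_diff:
  assumes "cvector_field M U X" "cvector_field M U Y"
  shows "cvector_field M U (conn_diff X Y)"
  unfolding conn_diff_def[abs_def]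
  using assms by (intro LC.cvector_field_diff CC.cvector_field_cnabla LC.cvector_field_cnabla)

lemmas fields = LC.cvector_field_cnabla CC.cvector_field_cnabla cvector_field_ctorsion
  cvector_field_clie_bracket cvector_field_conn_diff

text \<open>The bracket in the torsion of nabla is D_X Y - D_Y X, so that only differences of the
  two connections remain.\<close>

lemma ctorsion_conn_diff:
  assumes "cvector_field M U X" "cvector_field M U Y" "q \<in> U"
  shows "ctorsion M nab X Y q = (\<lambda>f. conn_diff Y X q f - conn_diff X Y q f)"
  by (simp add: ctorsion_eq clie_bracket_eq[OF assms] conn_diff_def fun_eq_iff)

lemma cmetric_cnabla_D:
  assumes "cvector_field M U X" "cvector_field M U Y" "cvector_field M U Z" "q \<in> U"
  shows "cmetric g q (cnabla D X Y q) (Z q) = cmetric g q (cnabla nab X Y q) (Z q) + cdiff3 X Y Z q"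
  by (simp add: cdiff3_def conn_diff_def LC.cmetric_diff[OF LC.field_topspace[OF assms(1,4)]
        cvector_field_ctangent[OF LC.cvector_field_cnabla[OF assms(1,2)] assms(4)]
        cvector_field_ctangent[OF CC.cvector_field_cnabla[OF assms(1,2)] assms(4)]
        cvector_field_ctangent[OF assms(3,4)]])

text \<open>Both connections are metric, so the two expansions of the derivative of <Y, Z> along X
  agree; their difference is S(X, Y, Z) + S(X, Z, Y) = 0.\<close>

lemma cdiff3_antisym:
  assumes "cvector_field M U X" "cvector_field M U Y" "cvector_field M U Z" "q \<in> U"
  shows "cdiff3 X Y Z q = - cdiff3 X Z Y q"
proof -
  note top = LC.field_topspace[OF assms(1,4)]
  have s: "cmetric g q (Y q) v = cmetric g q v (Y q)" if "v \<in> ctangent_space M q" for v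
    using LC.cmetric_commute[OF top cvector_field_ctangent[OF assms(2,4)] that] .
  note d = cvector_field_ctangent[OF LC.cvector_field_cnabla[OF assms(1,3)] assms(4)]
    cvector_field_ctangent[OF CC.cvector_field_cnabla[OF assms(1,3)] assms(4)]
  show ?thesis
    using LC.cmetric_compat[OF assms] CC.cmetric_compat[OF assms]
      cmetric_cnabla_D[OF assms] cmetric_cnabla_D[OF assms(1,3,2,4)] s[OF d(1)] s[OF d(2)]
    by (simp add: eq_neg_iff_add_eq_0)
qed

lemma cmetric_ctorsion:
  assumes "cvector_field M U X" "cvector_field M U Y" "cvector_field M U Z" "q \<in> U"
  shows "cmetric g q (ctorsion M nab X Y q) (Z q) = cdiff3 Y X Z q - cdiff3 X Y Z q"
  by (simp add: cdiff3_def ctorsion_conn_diff[OF assms(1,2,4)]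
      LC.cmetric_diff[OF LC.field_topspace[OF assms(1,4)]
        cvector_field_ctangent[OF cvector_field_conn_diff[OF assms(2,1)] assms(4)]
        cvector_field_ctangent[OF cvector_field_conn_diff[OF assms(1,2)] assms(4)]
        cvector_field_ctangent[OF assms(3,4)]])

lemma csmooth_fun_cdiff3:
  assumes "cvector_field M U X" "cvector_field M U Y" "cvector_field M U Z"
  shows "csmooth_fun M U (cdiff3 X Y Z)"
  unfolding cdiff3_def[abs_def] using assms fields by (intro LC.csmooth_fun_cmetric)

text \<open>This is (nabla_W S)(X, Y, Z), the covariant derivative of S for the canonical
  connection.\<close>

definition cdiff3_deriv ::
    "('a \<Rightarrow> 'a ctvec) \<Rightarrow> ('a \<Rightarrow> 'a ctvec) \<Rightarrow> ('a \<Rightarrow> 'a ctvec) \<Rightarrow> ('a \<Rightarrow> 'a ctvec) \<Rightarrow> 'a \<Rightarrow> complex" where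
  "cdiff3_deriv W X Y Z p = cderiv (W p) (cdiff3 X Y Z) - cdiff3 (cnabla nab W X) Y Z p
     - cdiff3 X (cnabla nab W Y) Z p - cdiff3 X Y (cnabla nab W Z) p"

lemma cdiff3_deriv_antisym:
  assumes "cvector_field M U W" "cvector_field M U X" "cvector_field M U Y" "cvector_field M U Z" "p \<in> U"
  shows "cdiff3_deriv W X Y Z p = - cdiff3_deriv W X Z Y p"
proof -
  note Wp = cvector_field_ctangent[OF assms(1,5)]
  have "cderiv (W p) (cdiff3 X Y Z) = cderiv (W p) (\<lambda>q. - cdiff3 X Z Y q)"
    by (rule cderiv_cong[OF Wp cvector_field_openin[OF assms(1)] assms(5)]) (rule cdiff3_antisym[OF assms(2,3,4)])
  also have "\<dots> = - cderiv (W p) (cdiff3 X Z Y)"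
    by (rule LC.cderiv_uminus[OF Wp csmooth_fun_cdiff3[OF assms(2,4,3)] assms(5)])
  finally have 1: "cderiv (W p) (cdiff3 X Y Z) = - cderiv (W p) (cdiff3 X Z Y)" .
  show ?thesis
    using cdiff3_antisym[OF CC.cvector_field_cnabla[OF assms(1,2)] assms(3,4,5)]
      cdiff3_antisym[OF assms(2) CC.cvector_field_cnabla[OF assms(1,3)] assms(4,5)]
      cdiff3_antisym[OF assms(2,3) CC.cvector_field_cnabla[OF assms(1,4)] assms(5)]
    by (simp add: cdiff3_deriv_def 1)
qed

text \<open>The relation <tau(X, Y), Z> = S(Y, X, Z) - S(X, Y, Z) is differentiated along W. As
  nabla is metric, the correction terms in X, Y and Z on the two sides match.\<close>

lemma cmetric_ctorsion_deriv:
  assumes "cvector_field M U W" "cvector_field M U X" "cvector_field M U Y" "cvector_field M U Z" "p \<in> U"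
  shows "cmetric g p (ctorsion_deriv M nab W X Y p) (Z p) = cdiff3_deriv W Y X Z p - cdiff3_deriv W X Y Z p"
proof -
  note Wp = cvector_field_ctangent[OF assms(1,5)] and Zp = cvector_field_ctangent[OF assms(4,5)]
  note top = LC.field_topspace[OF assms(1,5)]
  note n = CC.cvector_field_cnabla[OF assms(1,2)] CC.cvector_field_cnabla[OF assms(1,3)] CC.cvector_field_cnabla[OF assms(1,4)]
  note t = cvector_field_ctangent[OF CC.cvector_field_cnabla[OF assms(1) cvector_field_ctorsion[OF assms(2,3)]] assms(5)]
    cvector_field_ctangent[OF cvector_field_ctorsion[OF n(1) assms(3)] assms(5)]
    cvector_field_ctangent[OF cvector_field_ctorsion[OF assms(2) n(2)] assms(5)]
  have "cderiv (W p) (\<lambda>q. cmetric g q (ctorsion M nab X Y q) (Z q))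
      = cderiv (W p) (\<lambda>q. cdiff3 Y X Z q - cdiff3 X Y Z q)"
    by (rule cderiv_cong[OF Wp cvector_field_openin[OF assms(1)] assms(5)]) (rule cmetric_ctorsion[OF assms(2,3,4)])
  also have "\<dots> = cderiv (W p) (cdiff3 Y X Z) - cderiv (W p) (cdiff3 X Y Z)"
    by (rule LC.cderiv_diff[OF Wp csmooth_fun_cdiff3[OF assms(3,2,4)] csmooth_fun_cdiff3[OF assms(2-4)] assms(5)])
  finally have 1: "cmetric g p (cnabla nab W (ctorsion M nab X Y) p) (Z p)
     = cderiv (W p) (cdiff3 Y X Z) - cderiv (W p) (cdiff3 X Y Z)
       - (cdiff3 Y X (cnabla nab W Z) p - cdiff3 X Y (cnabla nab W Z) p)"
    using CC.cmetric_compat[OF assms(1) cvector_field_ctorsion[OF assms(2,3)] assms(4,5)]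
      cmetric_ctorsion[OF assms(2,3) n(3) assms(5)] by (simp add: algebra_simps)
  show ?thesis
    unfolding ctorsion_deriv_def
    by (simp add: LC.cmetric_diff[OF top _ _ Zp] ctangent_diff t 1 cdiff3_deriv_def
      cmetric_ctorsion[OF n(1) assms(3,4,5)] cmetric_ctorsion[OF assms(2) n(2) assms(4,5)])
qed

section \<open>Pointwise linearity of the difference tensor\<close>

lemma conn_diff_linear:
  assumes "cvector_field M U Y" "p \<in> U" "v \<in> ctangent_space M p" "w \<in> ctangent_space M p"
    and "X p = (\<lambda>f. c * v f + w f)"
  shows "conn_diff X Y p = (\<lambda>f. c * conn_diff (\<lambda>_. v) Y p f + conn_diff (\<lambda>_. w) Y p f)"
  using LC.cnabla_linear[of U Y p v w X c, OF assms] CC.cnabla_linear[of U Y p v w X c, OF assms]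
  by (simp add: conn_diff_def algebra_simps)

lemma conn_diff_point: "conn_diff X Y p = conn_diff (\<lambda>_. X p) Y p"
  by (simp add: conn_diff_def cnabla_def cbilinear_def)

lemma conn_diff_ctangent:
  assumes "cvector_field M U Y" "p \<in> U" "v \<in> ctangent_space M p"
  shows "conn_diff (\<lambda>_. v) Y p \<in> ctangent_space M p"
  unfolding conn_diff_def
  using assms by (intro ctangent_diff CC.cnabla_ctangent LC.cnabla_ctangent)

lemma cdiff3_point: "cdiff3 X Y Z p = cdiff3 (\<lambda>_. X p) Y Z p"
  unfolding cdiff3_def by (subst conn_diff_point) simp

lemma cdiff3_linear:
  assumes "cvector_field M U Y" "cvector_field M U Z" "p \<in> U" "v \<in> ctangent_space M p" "w \<in> ctangent_space M p"
  shows "cdiff3 (\<lambda>_ f. c * v f + w f) Y Z p = c * cdiff3 (\<lambda>_. v) Y Z p + cdiff3 (\<lambda>_. w) Y Z p"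
  unfolding cdiff3_def
  by (simp add: conn_diff_linear[OF assms(1,3,4,5) refl]
      LC.cmetric_linear[OF LC.field_topspace[OF assms(1,3)] conn_diff_ctangent[OF assms(1,3,4)]
        conn_diff_ctangent[OF assms(1,3,5)] cvector_field_ctangent[OF assms(2,3)]])

lemma conn_diff_diff:
  assumes "cvector_field M U X" "cvector_field M U X'" "cvector_field M U Y" "p \<in> U"
  shows "conn_diff (\<lambda>q f. X q f - X' q f) Y p = (\<lambda>f. conn_diff X Y p f - conn_diff X' Y p f)"
    and "conn_diff Y (\<lambda>q f. X q f - X' q f) p = (\<lambda>f. conn_diff Y X p f - conn_diff Y X' p f)"
proof -
  show "conn_diff (\<lambda>q f. X q f - X' q f) Y p = (\<lambda>f. conn_diff X Y p f - conn_diff X' Y p f)"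
    using conn_diff_linear[OF assms(3,4) cvector_field_ctangent[OF assms(2,4)] cvector_field_ctangent[OF assms(1,4)],
      of "\<lambda>q f. X q f - X' q f" "-1"]
    by (simp add: conn_diff_point[of X] conn_diff_point[of X'])
  show "conn_diff Y (\<lambda>q f. X q f - X' q f) p = (\<lambda>f. conn_diff Y X p f - conn_diff Y X' p f)"
    by (simp add: conn_diff_def LC.cnabla_diff[OF assms(3,1,2,4)] CC.cnabla_diff[OF assms(3,1,2,4)] fun_eq_iff)
qed

lemma ctorsion_diff:
  assumes "cvector_field M U X" "cvector_field M U X'" "cvector_field M U Y" "p \<in> U"
  shows "ctorsion M nab (\<lambda>q f. X q f - X' q f) Y p = (\<lambda>f. ctorsion M nab X Y p f - ctorsion M nab X' Y p f)"
  by (simp add: ctorsion_conn_diff[OF LC.cvector_field_diff[OF assms(1,2)] assms(3,4)]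
      ctorsion_conn_diff[OF assms(1,3,4)] ctorsion_conn_diff[OF assms(2,3,4)] conn_diff_diff[OF assms] fun_eq_iff)

lemma cdiff3_diff:
  assumes "cvector_field M U X" "cvector_field M U X'" "cvector_field M U Y" "cvector_field M U Z" "p \<in> U"
  shows "cdiff3 (\<lambda>q f. X q f - X' q f) Y Z p = cdiff3 X Y Z p - cdiff3 X' Y Z p"
  by (simp add: cdiff3_def conn_diff_diff[OF assms(1,2,3,5)] LC.cmetric_diff[OF LC.field_topspace[OF assms(1,5)]
        cvector_field_ctangent[OF cvector_field_conn_diff[OF assms(1,3)] assms(5)]
        cvector_field_ctangent[OF cvector_field_conn_diff[OF assms(2,3)] assms(5)]
        cvector_field_ctangent[OF assms(4,5)]])

text \<open>These are the three terms by which the antisymmetrised nabla S and the bracket term of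
  the curvature of D fail to match.\<close>

lemma cdiff3_ctorsion_left:
  assumes "cvector_field M U X" "cvector_field M U Y" "cvector_field M U V" "cvector_field M U W" "p \<in> U"
  shows "cdiff3 (ctorsion M nab X Y) V W p
    = cdiff3 (cnabla nab X Y) V W p - cdiff3 (cnabla nab Y X) V W p - cdiff3 (clie_bracket M X Y) V W p"
  unfolding ctorsion_eq
  using cdiff3_diff[OF _ _ assms(3-5)] assms(1,2) fields LC.cvector_field_diff by simp

section \<open>Curvature on vectors of type (1,0) and the first Bianchi identity\<close>

lemma cmetric_T10_fields:
  assumes "T10_field M J U X" "T10_field M J U Y" "q \<in> U"
  shows "cmetric g q (X q) (Y q) = 0"
  using assms LC.field_topspace[of U X q] by (auto simp: T10_field_def intro: LC.cmetric_T10)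

text \<open>As nabla_Y V is of type (1,0) and that bundle is isotropic, <D_Y V, W> is the function
  S(Y, V, W) on \<open>U\<close>. It is differentiated along X with nabla, and the outer D_X is
  recovered as nabla_X plus A.\<close>

lemma cmetric_D_D:
  assumes "cvector_field M U X" "cvector_field M U Y" "T10_field M J U V" "T10_field M J U W" "p \<in> U"
  shows "cmetric g p (cnabla D X (cnabla D Y V) p) (W p) =
    cderiv (X p) (cdiff3 Y V W) - cdiff3 Y V (cnabla nab X W) p + cdiff3 X (cnabla nab Y V) W p
    - cmetric g p (conn_diff X W p) (conn_diff Y V p)"
proof -
  have V: "cvector_field M U V" and W: "cvector_field M U W"
    using assms by (auto simp: T10_field_def)
  note DV = LC.cvector_field_cnabla[OF assms(2) V] and NV = CC.cvector_field_cnabla[OF assms(2) V]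
    and NW = CC.cvector_field_cnabla[OF assms(1) W]
  have eq: "cmetric g q (cnabla D Y V q) (W q) = cdiff3 Y V W q" if "q \<in> U" for q
    using cmetric_cnabla_D[OF assms(2) V W that]
      cmetric_T10_fields[OF T10_field_cnabla[OF assms(2,3)] assms(4) that] by simp
  have "cderiv (X p) (\<lambda>q. cmetric g q (cnabla D Y V q) (W q)) = cderiv (X p) (cdiff3 Y V W)"
    by (rule cderiv_cong[OF cvector_field_ctangent[OF assms(1,5)] cvector_field_openin[OF assms(1)] assms(5)])
      (rule eq)
  moreover have "cmetric g p (cnabla D Y V p) (cnabla nab X W p) = cdiff3 Y V (cnabla nab X W) p"
    using cmetric_cnabla_D[OF assms(2) V NW assms(5)]
      cmetric_T10_fields[OF T10_field_cnabla[OF assms(2,3)] T10_field_cnabla[OF assms(1,4)] assms(5)] by simp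
  ultimately have 1: "cmetric g p (cnabla nab X (cnabla D Y V) p) (W p)
      = cderiv (X p) (cdiff3 Y V W) - cdiff3 Y V (cnabla nab X W) p"
    using CC.cmetric_compat[OF assms(1) DV W assms(5)] by (simp add: eq_diff_eq)
  note top = LC.field_topspace[OF assms(1,5)]
  note t = cvector_field_ctangent[OF _ assms(5)]
  note A = t[OF cvector_field_conn_diff[OF assms(1) W]]
  \<comment> \<open>Skewness moves D_Y V to the last slot, where linearity of the metric splits it
    as A(Y, V) + nabla_Y V; the second part is moved back afterwards.\<close>
  have "cdiff3 X (cnabla D Y V) W p = - cmetric g p (conn_diff X W p) (cnabla D Y V p)"
    using cdiff3_antisym[OF assms(1) DV W assms(5)] by (simp add: cdiff3_def)
  also have "\<dots> = - (cmetric g p (conn_diff X W p) (conn_diff Y V p) + cdiff3 X W (cnabla nab Y V) p)"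
  proof -
    have e: "cnabla D Y V p = (\<lambda>f. conn_diff Y V p f + cnabla nab Y V p f)"
      by (simp add: conn_diff_def)
    note B = t[OF cvector_field_conn_diff[OF assms(2) V]]
    show ?thesis
      using LC.cmetric_commute[OF top A t[OF DV]] LC.cmetric_commute[OF top A B] LC.cmetric_commute[OF top A t[OF NV]]
        LC.cmetric_add[OF top B t[OF NV] A]
      by (simp add: cdiff3_def e)
  qed
  also have "\<dots> = cdiff3 X (cnabla nab Y V) W p - cmetric g p (conn_diff X W p) (conn_diff Y V p)"
    using cdiff3_antisym[OF assms(1) NV W assms(5)] by simp
  finally show ?thesis
    using cmetric_cnabla_D[OF assms(1) DV W assms(5)] 1 by simp
qed

text \<open>\<open>cmetric_D_D\<close> is antisymmetrised in X, Y and S([X, Y], V, W) subtracted.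
  Completing the result to covariant derivatives of S leaves S with nabla_X Y - nabla_Y X - [X, Y] =
  tau(X, Y) in its first slot.\<close>

lemma cmetric_ccurvature:
  assumes "cvector_field M U X" "cvector_field M U Y" "T10_field M J U V" "T10_field M J U W" "p \<in> U"
  shows "cmetric g p (ccurvature M D X Y V p) (W p) =
    cdiff3_deriv X Y V W p - cdiff3_deriv Y X V W p + cdiff3 (ctorsion M nab X Y) V W p
    - cmetric g p (conn_diff X W p) (conn_diff Y V p) + cmetric g p (conn_diff Y W p) (conn_diff X V p)"
proof -
  have V: "cvector_field M U V" and W: "cvector_field M U W"
    using assms by (auto simp: T10_field_def)
  note top = LC.field_topspace[OF assms(1,5)]
  note t = cvector_field_ctangent[OF _ assms(5)]
  note B = cvector_field_clie_bracket[OF assms(1,2)]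
  have "cmetric g p (cnabla D (clie_bracket M X Y) V p) (W p) = cdiff3 (clie_bracket M X Y) V W p"
    using cmetric_cnabla_D[OF B V W assms(5)] cmetric_T10_fields[OF T10_field_cnabla[OF B assms(3)] assms(4,5)] by simp
  then show ?thesis
    unfolding ccurvature_def
    using assms V W fields
    by (simp add: LC.cmetric_diff[OF top _ _ t[OF W]] ctangent_diff t[OF LC.cvector_field_cnabla]
      cmetric_D_D cdiff3_deriv_def cdiff3_ctorsion_left[where U=U])
qed

text \<open>Expanding the inner torsions produces the second covariant derivatives that form the
  curvatures of nabla. The terms of type tau(nabla_X Y, Z) and nabla_X [Y, Z] cancel in the cyclic
  sum, and the double brackets vanish by the Jacobi identity.\<close>

lemma first_bianchi:
  assumes "cvector_field M U X" "cvector_field M U Y" "cvector_field M U Z" "p \<in> U"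
  shows "ctorsion_deriv M nab X Y Z p f + ctorsion_deriv M nab Y Z X p f + ctorsion_deriv M nab Z X Y p f
    + ctorsion M nab (ctorsion M nab X Y) Z p f + ctorsion M nab (ctorsion M nab Y Z) X p f
    + ctorsion M nab (ctorsion M nab Z X) Y p f
    = ccurvature M nab X Y Z p f + ccurvature M nab Y Z X p f + ccurvature M nab Z X Y p f"
proof -
  have n: "cnabla nab X (ctorsion M nab Y Z) p f = cnabla nab X (cnabla nab Y Z) p f
      - cnabla nab X (cnabla nab Z Y) p f - cnabla nab X (clie_bracket M Y Z) p f"
    if F: "cvector_field M U X" "cvector_field M U Y" "cvector_field M U Z" for X Y Z
    unfolding ctorsion_eq
      CC.cnabla_diff[OF F(1) LC.cvector_field_diff[OF fields(2)[OF F(2,3)] fields(2)[OF F(3,2)]] fields(4)[OF F(2,3)] assms(4)]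
      CC.cnabla_diff[OF F(1) fields(2)[OF F(2,3)] fields(2)[OF F(3,2)] assms(4)] ..
  have t: "ctorsion M nab (ctorsion M nab X Y) Z p f = ctorsion M nab (cnabla nab X Y) Z p f
      - ctorsion M nab (cnabla nab Y X) Z p f - (cnabla nab (clie_bracket M X Y) Z p f
        - cnabla nab Z (clie_bracket M X Y) p f - clie_bracket M (clie_bracket M X Y) Z p f)"
    if F: "cvector_field M U X" "cvector_field M U Y" "cvector_field M U Z" for X Y Z
    unfolding ctorsion_eq[of X Y]
      ctorsion_diff[OF LC.cvector_field_diff[OF fields(2)[OF F(1,2)] fields(2)[OF F(2,1)]] fields(4)[OF F(1,2)] F(3) assms(4)]
      ctorsion_diff[OF fields(2)[OF F(1,2)] fields(2)[OF F(2,1)] F(3) assms(4)]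
      ctorsion_eq[of "clie_bracket M X Y"] ..
  show ?thesis
    \<comment> \<open>The instances of \<open>ctorsion_swap\<close> bring every covariant derivative
      inside a torsion to the first slot, the form in which these terms cancel.\<close>
    unfolding ctorsion_deriv_def ccurvature_def n[OF assms(1-3)] n[OF assms(2,3,1)] n[OF assms(3,1,2)]
      t[OF assms(1-3)] t[OF assms(2,3,1)] t[OF assms(3,1,2)]
      ctorsion_swap[of Z "cnabla nab X Y"] ctorsion_swap[of X "cnabla nab Y Z"] ctorsion_swap[of Y "cnabla nab Z X"]
      ctorsion_swap[of Y "cnabla nab X Z"] ctorsion_swap[of Z "cnabla nab Y X"] ctorsion_swap[of X "cnabla nab Z Y"]
    using LC.clie_bracket_jacobi[OF assms fields(4)[OF assms(1,2)] fields(4)[OF assms(2,3)] fields(4)[OF assms(3,1)], of f]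
    by (simp add: algebra_simps add_eq_0_iff)
qed

text \<open>nabla preserves type (1,0), so its curvature maps V to a vector of type (1,0), which
  pairs to zero with W by isotropy.\<close>

lemma cmetric_ccurvature_T10:
  assumes "cvector_field M U X" "cvector_field M U Y" "T10_field M J U V" "T10_field M J U W" "p \<in> U"
  shows "cmetric g p (ccurvature M nab X Y V p) (W p) = 0"
proof -
  have V: "cvector_field M U V" and W: "cvector_field M U W"
    using assms by (auto simp: T10_field_def)
  note top = LC.field_topspace[OF assms(1,5)]
  note t = cvector_field_ctangent[OF _ assms(5)]
  have z: "cmetric g p (cnabla nab X' V' p) (W p) = 0" if "cvector_field M U X'" "T10_field M J U V'" for X' V'
    using cmetric_T10_fields[OF T10_field_cnabla[OF that] assms(4,5)] .
  show ?thesis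
    unfolding ccurvature_def
    using assms V W fields
    by (simp add: LC.cmetric_diff[OF top _ _ t[OF W]] ctangent_diff t[OF CC.cvector_field_cnabla] z T10_field_cnabla)
qed

lemma ctorsion_deriv_ctangent:
  assumes "cvector_field M U X" "cvector_field M U Y" "cvector_field M U Z" "p \<in> U"
  shows "ctorsion_deriv M nab X Y Z p \<in> ctangent_space M p"
  unfolding ctorsion_deriv_def
  using assms(1-3) by (intro ctangent_diff cvector_field_ctangent[OF _ assms(4)] fields)

text \<open>Each of X, Y, Z is in turn the argument of the curvature in the cyclic sum; all being of
  type (1,0), the three curvature terms vanish when paired with W.\<close>

lemma cmetric_first_bianchi:
  assumes "T10_field M J U X" "T10_field M J U Y" "T10_field M J U Z" "T10_field M J U W" "p \<in> U"
  shows "cmetric g p (ctorsion_deriv M nab X Y Z p) (W p) + cmetric g p (ctorsion_deriv M nab Y Z X p) (W p)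
      + cmetric g p (ctorsion_deriv M nab Z X Y p) (W p)
    = - (cmetric g p (ctorsion M nab (ctorsion M nab X Y) Z p) (W p)
      + cmetric g p (ctorsion M nab (ctorsion M nab Y Z) X p) (W p)
      + cmetric g p (ctorsion M nab (ctorsion M nab Z X) Y p) (W p))"
proof -
  have F: "cvector_field M U X" "cvector_field M U Y" "cvector_field M U Z" "cvector_field M U W"
    using assms by (auto simp: T10_field_def)
  note top = LC.field_topspace[OF F(1) assms(5)]
  note t = cvector_field_ctangent[OF _ assms(5)]
  note add = LC.cmetric_add[OF top _ _ t[OF F(4)]]
  have tt: "ctorsion M nab (ctorsion M nab X Y) Z p \<in> ctangent_space M p"
    if "cvector_field M U X" "cvector_field M U Y" "cvector_field M U Z" for X Y Z
    using that by (intro t fields)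
  note td = ctorsion_deriv_ctangent[OF _ _ _ assms(5)]
  have tc: "ccurvature M nab X Y Z p \<in> ctangent_space M p"
    if "cvector_field M U X" "cvector_field M U Y" "cvector_field M U Z" for X Y Z
    unfolding ccurvature_def using that by (intro ctangent_diff t fields)
  have "cmetric g p (\<lambda>f. ctorsion_deriv M nab X Y Z p f + ctorsion_deriv M nab Y Z X p f + ctorsion_deriv M nab Z X Y p f
    + ctorsion M nab (ctorsion M nab X Y) Z p f + ctorsion M nab (ctorsion M nab Y Z) X p f
    + ctorsion M nab (ctorsion M nab Z X) Y p f) (W p)
    = cmetric g p (\<lambda>f. ccurvature M nab X Y Z p f + ccurvature M nab Y Z X p f + ccurvature M nab Z X Y p f) (W p)"
    using first_bianchi[OF F(1-3) assms(5)] by simp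
  then show ?thesis
    using F by (simp add: add ctangent_add tt td tc cmetric_ccurvature_T10[OF _ _ _ assms(4,5)] assms algebra_simps
        eq_neg_iff_add_eq_0)
qed

end

section \<open>Unitary frames\<close>

text \<open>Membership in \<open>ctangent_space\<close> is part of the conclusion because the
  induction needs it to apply linearity to the partial sum.\<close>

lemma linear_functional_sum:
  assumes "finite S" "\<And>i. i \<in> S \<Longrightarrow> v i \<in> ctangent_space M p"
    and lin: "\<And>c v w. v \<in> ctangent_space M p \<Longrightarrow> w \<in> ctangent_space M p \<Longrightarrow>
      \<phi> (\<lambda>f. c * v f + w f) = c * \<phi> v + (\<phi> w :: complex)"
  shows "(\<lambda>f. \<Sum>i\<in>S. c i * v i f) \<in> ctangent_space M p \<and>
    \<phi> (\<lambda>f. \<Sum>i\<in>S. c i * v i f) = (\<Sum>i\<in>S. c i * \<phi> (v i))"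
  using assms(1,2)
proof (induction S rule: finite_induct)
  case empty
  have z: "(\<lambda>f. 0) \<in> ctangent_space M p"
    by (simp add: ctangent_space_def tangent_space_def re_def im_def)
  \<comment> \<open>Additivity at 0 + 0 forces the value 0 at the zero vector.\<close>
  then show ?case using lin[OF z z, of 1] by simp
next
  case (insert x F)
  then show ?case
    using lin[of "v x" _ "c x"] by (simp add: linear_combination_ctangent_space)
qed

lemma sum_indices:
  "(\<Sum>A\<in>indices n. h A) = (\<Sum>i=1..n. h (Hol i)) + (\<Sum>i=1..n. (h (Bar i) :: 'b::comm_monoid_add))"
  unfolding indices_def
  by (subst sum.union_disjoint) (auto simp: sum.reindex inj_on_def)

locale unitary_frame_at = almost_hermitian_manifold n M J g
  for n and M :: "('a, 'e::euclidean_space) manifold" and J g +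
  fixes U e p
  assumes frame: "unitary_frame n M J g U e" and p: "p \<in> U"
begin

lemma T10_field_frame: "i \<in> {1..n} \<Longrightarrow> T10_field M J U (e i)"
  using frame unfolding unitary_frame_def by blast

lemma cvector_field_frame: "A \<in> indices n \<Longrightarrow> cvector_field M U (full_frame e A)"
proof (cases A)
  case (Hol i)
  then show "cvector_field M U (full_frame e A)" if "A \<in> indices n"
    using that T10_field_frame[of i] by (auto simp: indices_def T10_field_def)
next
  case (Bar i)
  then show "cvector_field M U (full_frame e A)" if "A \<in> indices n"
    using that T10_field_frame[of i] cvector_field_conj_field[of U "e i"] by (auto simp: indices_def T10_field_def)
qed

lemma frame_ctangent: "A \<in> indices n \<Longrightarrow> full_frame e A p \<in> ctangent_space M p"
  by (rule cvector_field_ctangent[OF cvector_field_frame p])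

lemma hol_bar_indices: "i \<in> {1..n} \<Longrightarrow> Hol i \<in> indices n" "i \<in> {1..n} \<Longrightarrow> Bar i \<in> indices n"
  by (auto simp: indices_def)

lemma topspace: "p \<in> topspace (mtop M)"
  using openin_subset[of "mtop M" U] frame p unfolding unitary_frame_def by blast

text \<open>Mixed products come from unitarity, those of type (1,0) vanish by isotropy, and those of
  the conjugates vanish because g is real: conjugating both arguments conjugates the value.\<close>

lemma cmetric_frame:
  assumes "i \<in> {1..n}" "j \<in> {1..n}"
  shows "cmetric g p (full_frame e (Hol i) p) (full_frame e (Bar j) p) = (if i = j then 1 else 0)"
    "cmetric g p (full_frame e (Bar i) p) (full_frame e (Hol j) p) = (if i = j then 1 else 0)"
    "cmetric g p (full_frame e (Hol i) p) (full_frame e (Hol j) p) = 0"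
    "cmetric g p (full_frame e (Bar i) p) (full_frame e (Bar j) p) = 0"
proof -
  note c = frame_ctangent[OF hol_bar_indices(1)] frame_ctangent[OF hol_bar_indices(2)]
  show 1: "cmetric g p (full_frame e (Hol i) p) (full_frame e (Bar j) p) = (if i = j then 1 else 0)"
    using frame p assms by (simp add: unitary_frame_def)
  have "cmetric g p (full_frame e (Hol j) p) (full_frame e (Bar i) p) = (if i = j then 1 else 0)"
    using frame p assms by (simp add: unitary_frame_def)
  then show "cmetric g p (full_frame e (Bar i) p) (full_frame e (Hol j) p) = (if i = j then 1 else 0)"
    using cmetric_commute[OF topspace c(1)[OF assms(2)] c(2)[OF assms(1)]] by simp
  show 2: "cmetric g p (full_frame e (Hol i) p) (full_frame e (Hol j) p) = 0"
    using T10_field_frame[OF assms(1)] T10_field_frame[OF assms(2)] p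
    by (simp add: T10_field_def cmetric_T10[OF topspace])
  have m: "g p (\<lambda>f. - x f) y = - g p x y" if "x \<in> tangent_space M p" "y \<in> tangent_space M p" for x y
    using g_linear[OF topspace that(1) that(1) that(2), of "-2"] by simp
  have neg: "(\<lambda>f. - x f) \<in> tangent_space M p" if "x \<in> tangent_space M p" for x
    using linear_combination_tangent_space[OF that that, of "-2"] by simp
  have m': "g p y (\<lambda>f. - x f) = - g p y x" if "x \<in> tangent_space M p" "y \<in> tangent_space M p" for x y
    using m[OF that] g_sym[OF topspace that(2) neg[OF that(1)]] g_sym[OF topspace that(2,1)] by simp
  have cnj: "cmetric g p (conj_field X p) (conj_field Y p) = cnj (cmetric g p (X p) (Y p))"
    if "X p \<in> ctangent_space M p" "Y p \<in> ctangent_space M p" for X Y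
  proof -
    have [simp]: "re (conj_field Z p) = re (Z p)" "im (conj_field Z p) = (\<lambda>f. - im (Z p) f)" for Z
      by (simp_all add: conj_field_def re_def im_def)
    show ?thesis
      using that m m' neg unfolding ctangent_space_def mem_Collect_eq
      by (simp add: cmetric_def complex_eq_iff)
  qed
  show "cmetric g p (full_frame e (Bar i) p) (full_frame e (Bar j) p) = 0"
    using cnj[of "e i" "e j"] 2 c(1)[OF assms(1)] c(1)[OF assms(2)] by simp
qed

text \<open>The frame is given as a basis of \<open>T10\<close> only. The (1,0) part (v - iJv)/2 is
  expanded directly and the (0,1) part through its conjugate, which is why the coefficients of the
  barred vectors appear conjugated.\<close>

lemma frame_spans:
  assumes v: "v \<in> ctangent_space M p"
  obtains c d where "v = (\<lambda>f. (\<Sum>m=1..n. c m * full_frame e (Hol m) p f) + (\<Sum>m=1..n. d m * full_frame e (Bar m) p f))"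
proof -
  have ex: "\<exists>c. w = (\<lambda>f. \<Sum>i=1..n. c i * e i p f)" if "w \<in> T10 M J p" for w
    using frame p that by (simp add: unitary_frame_def)
  define x y where "x = re v" and "y = im v"
  have xy: "x \<in> tangent_space M p" "y \<in> tangent_space M p"
    using v by (auto simp: ctangent_space_def x_def y_def)
  have veq: "v f = Complex (x f) (y f)" for f by (simp add: x_def y_def re_def im_def)
  note Jc = J_closed[OF topspace xy(1)] J_closed[OF topspace xy(2)]
  have lc: "(\<lambda>f. a * u f + b * w f) \<in> tangent_space M p"
    and Jl: "J p (\<lambda>f. a * u f + b * w f) = (\<lambda>f. a * J p u f + b * J p w f)"
    if uw: "u \<in> tangent_space M p" "w \<in> tangent_space M p" for a b u w
  proof -
    have bw: "(\<lambda>f. b * w f) \<in> tangent_space M p"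
      using linear_combination_tangent_space[OF uw(2,2), of "b - 1"] by (simp add: algebra_simps)
    show "(\<lambda>f. a * u f + b * w f) \<in> tangent_space M p"
      using linear_combination_tangent_space[OF uw(1) bw, of a] by simp
    show "J p (\<lambda>f. a * u f + b * w f) = (\<lambda>f. a * J p u f + b * J p w f)"
      using J_linear[OF topspace uw(1) bw, of a] J_linear[OF topspace uw(2,2), of "b - 1"]
      by (simp add: algebra_simps)
  qed
  \<comment> \<open>With v = x + iy, the choice t = 1/2 gives (v - iJv)/2, and t = -1/2 gives the
    same projection of the conjugate of v.\<close>
  have T: "(\<lambda>f. Complex (1/2 * x f + t * J p y f) (t * y f + (- 1/2) * J p x f)) \<in> T10 M J p" for t
  proof -
    have "(\<lambda>f. Complex (a * x f + t * J p y f) (t * y f + b * J p x f)) \<in> T10 M J p" if b: "a + b = 0" for a b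
    proof -
      have a: "a = - b" using b by simp
      show ?thesis
        using xy Jc
        by (simp add: T10_def ctangent_space_def cJ_def re_def im_def lc Jl J_square[OF topspace]
            fun_eq_iff complex_eq_iff) (simp add: a)
    qed
    from this[of "1/2" "- 1/2"] show ?thesis by simp
  qed
  obtain c where c: "(\<lambda>f. Complex (1/2 * x f + (1/2) * J p y f) ((1/2) * y f + (- 1/2) * J p x f)) = (\<lambda>f. \<Sum>i=1..n. c i * e i p f)"
    using ex[OF T[of "1/2"]] by blast
  obtain d where d: "(\<lambda>f. Complex (1/2 * x f + (-1/2) * J p y f) ((-1/2) * y f + (- 1/2) * J p x f)) = (\<lambda>f. \<Sum>i=1..n. d i * e i p f)"
    using ex[OF T[of "-1/2"]] by blast
  have "v f = (\<Sum>m=1..n. c m * e m p f) + (\<Sum>m=1..n. cnj (d m) * conj_field (e m) p f)" for f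
  proof -
    have "(\<Sum>m=1..n. cnj (d m) * conj_field (e m) p f) = cnj (\<Sum>m=1..n. d m * e m p f)"
      by (simp add: conj_field_def)
    then show ?thesis
      unfolding fun_cong[OF c, of f, symmetric] fun_cong[OF d, of f, symmetric]
      by (simp add: veq complex_eq_iff)
  qed
  then show thesis using that[of c "\<lambda>m. cnj (d m)"] by (simp add: fun_eq_iff)
qed

lemma linear_functional_frame_sum:
  assumes lin: "\<And>c v w. v \<in> ctangent_space M p \<Longrightarrow> w \<in> ctangent_space M p \<Longrightarrow>
      \<phi> (\<lambda>f. c * v f + w f) = c * \<phi> v + (\<phi> w :: complex)"
  shows "\<phi> (\<lambda>f. (\<Sum>m=1..n. c m * full_frame e (Hol m) p f) + (\<Sum>m=1..n. d m * full_frame e (Bar m) p f))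
    = (\<Sum>m=1..n. c m * \<phi> (full_frame e (Hol m) p)) + (\<Sum>m=1..n. d m * \<phi> (full_frame e (Bar m) p))"
proof -
  have h: "(\<lambda>f. \<Sum>m=1..n. c m * full_frame e (Hol m) p f) \<in> ctangent_space M p \<and>
      \<phi> (\<lambda>f. \<Sum>m=1..n. c m * full_frame e (Hol m) p f) = (\<Sum>m=1..n. c m * \<phi> (full_frame e (Hol m) p))"
    by (rule linear_functional_sum) (use frame_ctangent hol_bar_indices lin in \<open>auto simp del: full_frame.simps\<close>)
  have b: "(\<lambda>f. \<Sum>m=1..n. d m * full_frame e (Bar m) p f) \<in> ctangent_space M p \<and>
      \<phi> (\<lambda>f. \<Sum>m=1..n. d m * full_frame e (Bar m) p f) = (\<Sum>m=1..n. d m * \<phi> (full_frame e (Bar m) p))"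
    by (rule linear_functional_sum) (use frame_ctangent hol_bar_indices lin in \<open>auto simp del: full_frame.simps\<close>)
  show ?thesis
    using lin[of _ _ 1] h b by simp
qed

text \<open>The frame is dual to its own conjugate under the bilinear metric, so all terms but one
  drop out. In particular the coefficients of an expansion are unique.\<close>

lemma cmetric_frame_sum:
  assumes "j \<in> {1..n}"
  shows "cmetric g p (\<lambda>f. (\<Sum>m=1..n. c m * full_frame e (Hol m) p f) + (\<Sum>m=1..n. d m * full_frame e (Bar m) p f))
      (full_frame e (Bar j) p) = c j"
    "cmetric g p (\<lambda>f. (\<Sum>m=1..n. c m * full_frame e (Hol m) p f) + (\<Sum>m=1..n. d m * full_frame e (Bar m) p f))
      (full_frame e (Hol j) p) = d j"
proof -
  note c = frame_ctangent[OF hol_bar_indices(1)[OF assms]] frame_ctangent[OF hol_bar_indices(2)[OF assms]]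
  note l = linear_functional_frame_sum[of "\<lambda>v. cmetric g p v (full_frame e A p)" for A, of "Bar j" c d]
    linear_functional_frame_sum[of "\<lambda>v. cmetric g p v (full_frame e A p)" for A, of "Hol j" c d]
  have "(\<Sum>m=1..n. c m * cmetric g p (full_frame e (Hol m) p) (full_frame e (Bar j) p)) = (\<Sum>m=1..n. if m = j then c m else 0)"
    "(\<Sum>m=1..n. d m * cmetric g p (full_frame e (Bar m) p) (full_frame e (Hol j) p)) = (\<Sum>m=1..n. if m = j then d m else 0)"
    "(\<Sum>m=1..n. c m * cmetric g p (full_frame e (Hol m) p) (full_frame e (Hol j) p)) = 0"
    "(\<Sum>m=1..n. d m * cmetric g p (full_frame e (Bar m) p) (full_frame e (Bar j) p)) = 0"
    using assms by (auto intro!: sum.cong[OF refl] sum.neutral simp: cmetric_frame simp del: full_frame.simps sum.delta sum.delta')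
  then show "cmetric g p (\<lambda>f. (\<Sum>m=1..n. c m * full_frame e (Hol m) p f) + (\<Sum>m=1..n. d m * full_frame e (Bar m) p f))
      (full_frame e (Bar j) p) = c j"
    "cmetric g p (\<lambda>f. (\<Sum>m=1..n. c m * full_frame e (Hol m) p f) + (\<Sum>m=1..n. d m * full_frame e (Bar m) p f))
      (full_frame e (Hol j) p) = d j"
    using l cmetric_linear[OF topspace _ _ c(1)] cmetric_linear[OF topspace _ _ c(2)] assms
    by (simp_all del: full_frame.simps)
qed

lemma frame_expansion:
  assumes "v \<in> ctangent_space M p"
  shows "v = (\<lambda>f. (\<Sum>m=1..n. cmetric g p v (full_frame e (Bar m) p) * full_frame e (Hol m) p f)
    + (\<Sum>m=1..n. cmetric g p v (full_frame e (Hol m) p) * full_frame e (Bar m) p f))"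
proof -
  obtain c d where cd: "v = (\<lambda>f. (\<Sum>m=1..n. c m * full_frame e (Hol m) p f) + (\<Sum>m=1..n. d m * full_frame e (Bar m) p f))"
    using frame_spans[OF assms] .
  have e: "c m = cmetric g p v (full_frame e (Bar m) p)" "d m = cmetric g p v (full_frame e (Hol m) p)" if "m \<in> {1..n}" for m
    unfolding cd by (simp_all only: cmetric_frame_sum[OF that])
  show ?thesis
    by (subst cd, intro ext arg_cong2[where f = "(+)"] sum.cong refl)
      (simp_all add: e del: full_frame.simps)
qed

text \<open>The functional is abstract because the expansion is used both for the metric and for the
  first slot of S.\<close>

lemma linear_functional_expansion:
  assumes "v \<in> ctangent_space M p"
    and "\<And>c v w. v \<in> ctangent_space M p \<Longrightarrow> w \<in> ctangent_space M p \<Longrightarrow>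
      \<phi> (\<lambda>f. c * v f + w f) = c * \<phi> v + (\<phi> w :: complex)"
  shows "\<phi> v = (\<Sum>m=1..n. cmetric g p v (full_frame e (Bar m) p) * \<phi> (full_frame e (Hol m) p)
    + cmetric g p v (full_frame e (Hol m) p) * \<phi> (full_frame e (Bar m) p))"
  unfolding sum.distrib
  using arg_cong[OF frame_expansion[OF assms(1)], of \<phi>]
    linear_functional_frame_sum[of \<phi>, OF assms(2)] by (rule trans)

lemma cmetric_expansion:
  assumes "v \<in> ctangent_space M p" "w \<in> ctangent_space M p"
  shows "cmetric g p v w = (\<Sum>m=1..n.
      cmetric g p v (full_frame e (Bar m) p) * cmetric g p w (full_frame e (Hol m) p)
    + cmetric g p v (full_frame e (Hol m) p) * cmetric g p w (full_frame e (Bar m) p))"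
proof -
  have c: "cmetric g p (full_frame e A p) w = cmetric g p w (full_frame e A p)" if "A \<in> indices n" for A
    using cmetric_commute[OF topspace frame_ctangent[OF that] assms(2)] .
  have "cmetric g p v w = (\<Sum>m=1..n.
      cmetric g p v (full_frame e (Bar m) p) * cmetric g p (full_frame e (Hol m) p) w
    + cmetric g p v (full_frame e (Hol m) p) * cmetric g p (full_frame e (Bar m) p) w)"
    by (rule linear_functional_expansion[OF assms(1)]) (rule cmetric_linear[OF topspace _ _ assms(2)])
  then show ?thesis
    by (simp only: c[OF hol_bar_indices(1)] c[OF hol_bar_indices(2)] cong: sum.cong)
qed

text \<open>Existence for the definite description is \<open>frame_expansion\<close>. Uniqueness
  follows by pairing with the frame, and outside \<open>indices n\<close> from the prescribed value
  0.\<close>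

lemma frame_coeff:
  assumes "v \<in> ctangent_space M p" "j \<in> {1..n}"
  shows "frame_coeff n e p v (Hol j) = cmetric g p v (full_frame e (Bar j) p)"
    "frame_coeff n e p v (Bar j) = cmetric g p v (full_frame e (Hol j) p)"
proof -
  define c where "c A = (if A \<in> indices n then
    (case A of Hol m \<Rightarrow> cmetric g p v (full_frame e (Bar m) p) | Bar m \<Rightarrow> cmetric g p v (full_frame e (Hol m) p)) else 0)" for A
  have c: "c (Hol m) = cmetric g p v (full_frame e (Bar m) p)" "c (Bar m) = cmetric g p v (full_frame e (Hol m) p)"
    if "m \<in> {1..n}" for m
    using that by (simp_all add: c_def hol_bar_indices del: full_frame.simps)
  have "frame_coeff n e p v = c"
    unfolding frame_coeff_def
  proof (rule the_equality)
    show "(\<forall>A. A \<notin> indices n \<longrightarrow> c A = 0) \<and> v = (\<lambda>f. \<Sum>A\<in>indices n. c A * full_frame e A p f)"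
    proof
      show "v = (\<lambda>f. \<Sum>A\<in>indices n. c A * full_frame e A p f)"
        by (rule trans[OF frame_expansion[OF assms(1)]])
          (intro ext, unfold sum_indices, intro arg_cong2[where f = "(+)"] sum.cong refl,
           simp_all add: c del: full_frame.simps)
    qed (simp add: c_def)
  next
    fix c' assume c': "(\<forall>A. A \<notin> indices n \<longrightarrow> c' A = 0) \<and> v = (\<lambda>f. \<Sum>A\<in>indices n. c' A * full_frame e A p f)"
    then have "v = (\<lambda>f. (\<Sum>m=1..n. c' (Hol m) * full_frame e (Hol m) p f) + (\<Sum>m=1..n. c' (Bar m) * full_frame e (Bar m) p f))"
      by (simp add: sum_indices)
    then have e: "c' (Hol m) = c (Hol m)" "c' (Bar m) = c (Bar m)" if "m \<in> {1..n}" for m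
      unfolding c[OF that] by (simp_all only: cmetric_frame_sum[OF that])
    show "c' = c"
    proof
      fix A show "c' A = c A"
        using e c' by (cases "A \<in> indices n") (auto simp: indices_def c_def)
    qed
  qed
  then show "frame_coeff n e p v (Hol j) = cmetric g p v (full_frame e (Bar j) p)"
    "frame_coeff n e p v (Bar j) = cmetric g p v (full_frame e (Hol j) p)"
    using c[OF assms(2)] by simp_all
qed

end

section \<open>Components in a unitary frame\<close>

locale canonical_and_levi_civita_frame =
  canonical_and_levi_civita n M J g D nab + unitary_frame_at n M J g U e p
  for n and M :: "('a, 'e::euclidean_space) manifold" and J g D nab U e p
begin

text \<open>Since \<open>\<langle>e\<^sub>C, e\<^sub>D\<rangle> = 1\<close> exactly for \<open>D\<close> the conjugate index of \<open>C\<close>, the value \<open>T A B C\<close> is the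
  torsion coefficient whose upper index is the conjugate of \<open>C\<close>. In \<open>dT\<close> and \<open>dS\<close> the direction of
  differentiation comes first.\<close>

definition T :: "index \<Rightarrow> index \<Rightarrow> index \<Rightarrow> complex" where
  "T A B C = cmetric g p (ctorsion M nab (full_frame e A) (full_frame e B) p) (full_frame e C p)"

definition S :: "index \<Rightarrow> index \<Rightarrow> index \<Rightarrow> complex" where
  "S A B C = cdiff3 (full_frame e A) (full_frame e B) (full_frame e C) p"

definition dT :: "index \<Rightarrow> index \<Rightarrow> index \<Rightarrow> index \<Rightarrow> complex" where
  "dT E A B C = cmetric g p (ctorsion_deriv M nab (full_frame e E) (full_frame e A) (full_frame e B) p) (full_frame e C p)"

definition dS :: "index \<Rightarrow> index \<Rightarrow> index \<Rightarrow> index \<Rightarrow> complex" where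
  "dS E A B C = cdiff3_deriv (full_frame e E) (full_frame e A) (full_frame e B) (full_frame e C) p"

section \<open>Symmetries of the components and the Koszul relations\<close>

lemma T_swap: "T A B C = - T B A C" if "A \<in> indices n" "B \<in> indices n" "C \<in> indices n"
  unfolding T_def
  using cmetric_ctorsion[OF cvector_field_frame[OF that(1)] cvector_field_frame[OF that(2)] cvector_field_frame[OF that(3)] p]
    cmetric_ctorsion[OF cvector_field_frame[OF that(2)] cvector_field_frame[OF that(1)] cvector_field_frame[OF that(3)] p]
  by simp

lemma T_mixed:
  assumes "a \<in> {1..n}" "b \<in> {1..n}" "C \<in> indices n"
  shows "T (Hol a) (Bar b) C = 0" "T (Bar b) (Hol a) C = 0"
proof -
  have "ctorsion M nab (full_frame e (Hol a)) (full_frame e (Bar b)) p = (\<lambda>f. 0)"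
    using torsion_mixed[OF T10_field_frame[OF assms(1)] T10_field_frame[OF assms(2)] p] by simp
  moreover have "cmetric g p (\<lambda>f. 0) v = 0" if "v \<in> ctangent_space M p" for v
    using LC.cmetric_diff[OF topspace that that that] by simp
  ultimately show 1: "T (Hol a) (Bar b) C = 0"
    by (simp add: T_def frame_ctangent[OF assms(3)] del: full_frame.simps)
  then show "T (Bar b) (Hol a) C = 0"
    using T_swap[OF hol_bar_indices(2)[OF assms(2)] hol_bar_indices(1)[OF assms(1)] assms(3)] by simp
qed

text \<open>Koszul's argument: when T A B C - T B C A + T C A B is written through S, the two terms
  with B in the first slot cancel by skewness, likewise those with C, and those with A add up to -2
  S A B C.\<close>

lemma S_eq:
  assumes "A \<in> indices n" "B \<in> indices n" "C \<in> indices n"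
  shows "S A B C = - (T A B C - T B C A + T C A B) / 2"
proof -
  note F = assms[THEN cvector_field_frame]
  show ?thesis
    unfolding T_def S_def cmetric_ctorsion[OF F(1,2,3) p] cmetric_ctorsion[OF F(2,3,1) p] cmetric_ctorsion[OF F(3,1,2) p]
    using cdiff3_antisym[OF F(1,2,3) p] cdiff3_antisym[OF F(2,3,1) p] cdiff3_antisym[OF F(3,1,2) p]
    by simp
qed

text \<open>The same elimination as in \<open>S_eq\<close>, since nabla S inherits the skewness of S
  and is related to nabla tau in the same way.\<close>

lemma dS_eq:
  assumes "E \<in> indices n" "A \<in> indices n" "B \<in> indices n" "C \<in> indices n"
  shows "dS E A B C = - (dT E A B C - dT E B C A + dT E C A B) / 2"
proof -
  note F = assms[THEN cvector_field_frame]
  show ?thesis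
    unfolding dT_def dS_def cmetric_ctorsion_deriv[OF F(1,2,3,4) p] cmetric_ctorsion_deriv[OF F(1,3,4,2) p]
      cmetric_ctorsion_deriv[OF F(1,4,2,3) p]
    using cdiff3_deriv_antisym[OF F(1,2,3,4) p] cdiff3_deriv_antisym[OF F(1,3,4,2) p] cdiff3_deriv_antisym[OF F(1,4,2,3) p]
    by simp
qed

lemma dT_swap:
  assumes "E \<in> indices n" "A \<in> indices n" "B \<in> indices n" "C \<in> indices n"
  shows "dT E A B C = - dT E B A C"
proof -
  note F = assms[THEN cvector_field_frame]
  show ?thesis
    unfolding dT_def cmetric_ctorsion_deriv[OF F(1,2,3,4) p] cmetric_ctorsion_deriv[OF F(1,3,2,4) p] by simp
qed

section \<open>Frame expansion of the quadratic terms and the Bianchi identity in components\<close>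

lemma conn_diff_frame:
  assumes "A \<in> indices n" "B \<in> indices n"
  shows "conn_diff (full_frame e A) (full_frame e B) p \<in> ctangent_space M p"
  using cvector_field_ctangent[OF cvector_field_conn_diff[OF assms[THEN cvector_field_frame]] p] .

lemma ctorsion_frame:
  assumes "A \<in> indices n" "B \<in> indices n"
  shows "ctorsion M nab (full_frame e A) (full_frame e B) p \<in> ctangent_space M p"
  using cvector_field_ctangent[OF cvector_field_ctorsion[OF assms[THEN cvector_field_frame]] p] .

lemma cdiff3_ctorsion_frame:
  assumes "A \<in> indices n" "B \<in> indices n" "C \<in> indices n" "E \<in> indices n"
  shows "cdiff3 (ctorsion M nab (full_frame e A) (full_frame e B)) (full_frame e C) (full_frame e E) p
    = (\<Sum>m=1..n. T A B (Bar m) * S (Hol m) C E + T A B (Hol m) * S (Bar m) C E)"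
proof -
  have "cdiff3 (\<lambda>_. ctorsion M nab (full_frame e A) (full_frame e B) p) (full_frame e C) (full_frame e E) p
    = (\<Sum>m=1..n. T A B (Bar m) * cdiff3 (\<lambda>_. full_frame e (Hol m) p) (full_frame e C) (full_frame e E) p
      + T A B (Hol m) * cdiff3 (\<lambda>_. full_frame e (Bar m) p) (full_frame e C) (full_frame e E) p)"
    unfolding T_def
    by (rule linear_functional_expansion[OF ctorsion_frame[OF assms(1,2)]])
      (rule cdiff3_linear[OF cvector_field_frame[OF assms(3)] cvector_field_frame[OF assms(4)] p])
  then show ?thesis
    unfolding S_def cdiff3_point[symmetric] .
qed

lemma cmetric_conn_diff_frame:
  assumes "A \<in> indices n" "B \<in> indices n" "C \<in> indices n" "E \<in> indices n"
  shows "cmetric g p (conn_diff (full_frame e A) (full_frame e B) p) (conn_diff (full_frame e C) (full_frame e E) p)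
    = (\<Sum>m=1..n. S A B (Bar m) * S C E (Hol m) + S A B (Hol m) * S C E (Bar m))"
  unfolding S_def cdiff3_def
  by (rule cmetric_expansion[OF conn_diff_frame[OF assms(1,2)] conn_diff_frame[OF assms(3,4)]])

text \<open>The inner torsion occurs once in the first slot of S, which is pointwise linear, and
  once in the second. From there skewness moves it to the last slot, where the metric can be
  expanded in the frame.\<close>

lemma cmetric_ctorsion_ctorsion_frame:
  assumes "A \<in> indices n" "B \<in> indices n" "C \<in> indices n" "E \<in> indices n"
  shows "cmetric g p (ctorsion M nab (ctorsion M nab (full_frame e A) (full_frame e B)) (full_frame e C) p) (full_frame e E p)
    = - (\<Sum>m=1..n. S C E (Bar m) * T A B (Hol m) + S C E (Hol m) * T A B (Bar m)
                  + T A B (Bar m) * S (Hol m) C E + T A B (Hol m) * S (Bar m) C E)"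
proof -
  note F = assms[THEN cvector_field_frame]
  note FT = cvector_field_ctorsion[OF F(1,2)]
  have "cdiff3 (full_frame e C) (ctorsion M nab (full_frame e A) (full_frame e B)) (full_frame e E) p
    = - (\<Sum>m=1..n. S C E (Bar m) * T A B (Hol m) + S C E (Hol m) * T A B (Bar m))"
    unfolding cdiff3_antisym[OF F(3) FT F(4) p]
    unfolding S_def T_def cdiff3_def
    by (subst cmetric_expansion[OF conn_diff_frame[OF assms(3,4)] ctorsion_frame[OF assms(1,2)]]) (rule refl)
  then show ?thesis
    unfolding cmetric_ctorsion[OF FT F(3,4) p] cdiff3_ctorsion_frame[OF assms]
    by (simp add: sum.distrib)
qed

lemma first_bianchi_frame:
  assumes "i \<in> {1..n}" "j \<in> {1..n}" "k \<in> {1..n}" "l \<in> {1..n}"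
  shows "dT (Hol i) (Hol j) (Hol k) (Hol l) + dT (Hol j) (Hol k) (Hol i) (Hol l) + dT (Hol k) (Hol i) (Hol j) (Hol l)
    = - (\<Sum>m=1..n. T (Hol i) (Hol j) (Bar m) * T (Hol m) (Hol k) (Hol l)
                  + T (Hol j) (Hol k) (Bar m) * T (Hol m) (Hol i) (Hol l)
                  + T (Hol k) (Hol i) (Bar m) * T (Hol m) (Hol j) (Hol l))"
proof -
  have t: "cmetric g p (ctorsion M nab (ctorsion M nab (full_frame e (Hol a)) (full_frame e (Hol b))) (full_frame e (Hol c)) p)
      (full_frame e (Hol d) p) = (\<Sum>m=1..n. T (Hol a) (Hol b) (Bar m) * T (Hol m) (Hol c) (Hol d))"
    if "a \<in> {1..n}" "b \<in> {1..n}" "c \<in> {1..n}" "d \<in> {1..n}" for a b c d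
    unfolding cmetric_ctorsion_ctorsion_frame[OF that[THEN hol_bar_indices(1)]] sum_negf[symmetric]
  proof (intro sum.cong refl)
    \<comment> \<open>By \<open>T_mixed\<close>, S c d (Bar m) and - S (Bar m) c d both equal - T c
      d (Bar m) / 2, so the terms with the factor T a b (Hol m) cancel. The Koszul relation merges
      the other two into one torsion component.\<close>
    fix m assume m: "m \<in> {1..n}"
    note ix = that[THEN hol_bar_indices(1)] hol_bar_indices[OF m]
    show "- (S (Hol c) (Hol d) (Bar m) * T (Hol a) (Hol b) (Hol m) + S (Hol c) (Hol d) (Hol m) * T (Hol a) (Hol b) (Bar m)
        + T (Hol a) (Hol b) (Bar m) * S (Hol m) (Hol c) (Hol d) + T (Hol a) (Hol b) (Hol m) * S (Bar m) (Hol c) (Hol d))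
      = T (Hol a) (Hol b) (Bar m) * T (Hol m) (Hol c) (Hol d)"
      using that m T_swap[OF ix(4,3), of "Bar m"] T_swap[OF ix(5,3,4)] T_swap[OF ix(5,4,3)] T_swap[OF ix(4,3,5)] ix
      by (simp add: S_eq T_mixed field_simps)
  qed
  show ?thesis
    using cmetric_first_bianchi[OF assms[THEN T10_field_frame] p]
      t[OF assms] t[OF assms(2,3,1,4)] t[OF assms(3,1,2,4)]
    by (simp add: dT_def sum.distrib)
qed

text \<open>As R_ijkl = <R(e_k, e_l)e_i, e_j>, the indices k, l are the directions and i, j the two
  type (1,0) arguments of \<open>cmetric_ccurvature\<close>.\<close>

lemma curvature_frame:
  assumes "i \<in> {1..n}" "j \<in> {1..n}" "k \<in> {1..n}" "l \<in> {1..n}"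
  shows "curvature_coeff M g D e p (Hol i) (Hol j) (Hol k) (Hol l)
    = dS (Hol k) (Hol l) (Hol i) (Hol j) - dS (Hol l) (Hol k) (Hol i) (Hol j)
    + (\<Sum>m=1..n. T (Hol k) (Hol l) (Bar m) * S (Hol m) (Hol i) (Hol j) + T (Hol k) (Hol l) (Hol m) * S (Bar m) (Hol i) (Hol j))
    - (\<Sum>m=1..n. S (Hol k) (Hol j) (Bar m) * S (Hol l) (Hol i) (Hol m) + S (Hol k) (Hol j) (Hol m) * S (Hol l) (Hol i) (Bar m))
    + (\<Sum>m=1..n. S (Hol l) (Hol j) (Bar m) * S (Hol k) (Hol i) (Hol m) + S (Hol l) (Hol j) (Hol m) * S (Hol k) (Hol i) (Bar m))"
proof -
  note ix = assms[THEN hol_bar_indices(1)]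
  note F = ix[THEN cvector_field_frame]
  have F': "T10_field M J U (full_frame e (Hol i))" "T10_field M J U (full_frame e (Hol j))"
    using assms[THEN T10_field_frame] by simp_all
  show ?thesis
    unfolding curvature_coeff_def curvature4_def dS_def cdiff3_ctorsion_frame[OF ix(3,4,1,2), symmetric]
      cmetric_conn_diff_frame[OF ix(3,2,4,1), symmetric] cmetric_conn_diff_frame[OF ix(4,2,3,1), symmetric]
    by (rule cmetric_ccurvature[OF F(3,4) F' p])
qed

text \<open>Here \<open>t\<close> and \<open>u\<close> are the torsion coefficients with unbarred
  and barred upper index. After the Koszul relations, four of the derivative terms still have the
  wrong shape; two Bianchi identities replace them, and their quadratic sides are absorbed into the
  sums.\<close>

lemma curvature_frame_torsion:
  assumes "i \<in> {1..n}" "j \<in> {1..n}" "k \<in> {1..n}" "l \<in> {1..n}"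
  defines "t \<equiv> \<lambda>a b m. T (Hol a) (Hol b) (Bar m)" and "u \<equiv> \<lambda>a b m. T (Hol a) (Hol b) (Hol m)"
  shows "curvature_coeff M g D e p (Hol i) (Hol j) (Hol k) (Hol l) =
      1/2 * (dT (Hol i) (Hol k) (Hol l) (Hol j) - dT (Hol j) (Hol k) (Hol l) (Hol i))
    + 1/2 * (dT (Hol k) (Hol i) (Hol j) (Hol l) - dT (Hol l) (Hol i) (Hol j) (Hol k))
    + 1/2 * (\<Sum>m=1..n. t i j m * u k l m + u i j m * t k l m)
    + 1/4 * (\<Sum>m=1..n. t i k m * (u j l m - u l m j - u m j l))
    + 1/4 * (\<Sum>m=1..n. t j l m * (u i k m - u k m i - u m i k))
    - 1/4 * (\<Sum>m=1..n. t i l m * (u j k m - u k m j - u m j k))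
    - 1/4 * (\<Sum>m=1..n. t j k m * (u i l m - u l m i - u m i l))"
proof -
  note h = assms(1-4)[THEN hol_bar_indices(1)]
  \<comment> \<open>With one barred index, \<open>T_mixed\<close> kills two of the three terms of
    the Koszul relation.\<close>
  have S1: "S (Hol a) (Hol b) (Bar m) = - t a b m / 2" "S (Bar m) (Hol a) (Hol b) = t a b m / 2"
    "S (Hol a) (Hol b) (Hol c) = - (u a b c - u b c a + u c a b) / 2"
    if "a \<in> {1..n}" "b \<in> {1..n}" "m \<in> {1..n}" "c \<in> {1..n}" for a b c m
    using that by (simp_all add: S_eq T_mixed hol_bar_indices t_def u_def)
  have sw: "t a b m = - t b a m" "u a b m = - u b a m" if "a \<in> {1..n}" "b \<in> {1..n}" "m \<in> {1..n}" for a b m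
    using T_swap that hol_bar_indices unfolding t_def u_def by blast+
  \<comment> \<open>Bianchi for k, l, i paired with j, and next for k, l, j paired with i. Each
    trades two derivatives in the directions k and l for one in the direction i or j.\<close>
  have B1: "dT (Hol k) (Hol l) (Hol i) (Hol j) + dT (Hol l) (Hol i) (Hol k) (Hol j) + dT (Hol i) (Hol k) (Hol l) (Hol j)
     + (\<Sum>m=1..n. t k l m * u m i j + t l i m * u m k j + t i k m * u m l j) = 0"
    using first_bianchi_frame[OF assms(3,4,1,2)] by (simp add: t_def u_def)
  have B2: "dT (Hol k) (Hol l) (Hol j) (Hol i) + dT (Hol l) (Hol j) (Hol k) (Hol i) + dT (Hol j) (Hol k) (Hol l) (Hol i)
     + (\<Sum>m=1..n. t k l m * u m j i + t l j m * u m k i + t j k m * u m l i) = 0"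
    using first_bianchi_frame[OF assms(3,4,2,1)] by (simp add: t_def u_def)
  have R: "curvature_coeff M g D e p (Hol i) (Hol j) (Hol k) (Hol l)
    = dS (Hol k) (Hol l) (Hol i) (Hol j) - dS (Hol l) (Hol k) (Hol i) (Hol j)
    + (\<Sum>m=1..n. (t k l m * (- (u m i j - u i j m + u j m i) / 2) + u k l m * (t i j m / 2))
      - ((- t k j m / 2) * (- (u l i m - u i m l + u m l i) / 2) + (- (u k j m - u j m k + u m k j) / 2) * (- t l i m / 2))
      + ((- t l j m / 2) * (- (u k i m - u i m k + u m k i) / 2) + (- (u l j m - u j m l + u m l j) / 2) * (- t k i m / 2)))"
    (is "_ = _ - _ + (\<Sum>m=1..n. ?q m)")
  proof -
    have "(\<Sum>m=1..n. ?q m) = (\<Sum>m=1..n.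
        (T (Hol k) (Hol l) (Bar m) * S (Hol m) (Hol i) (Hol j) + T (Hol k) (Hol l) (Hol m) * S (Bar m) (Hol i) (Hol j))
      - (S (Hol k) (Hol j) (Bar m) * S (Hol l) (Hol i) (Hol m) + S (Hol k) (Hol j) (Hol m) * S (Hol l) (Hol i) (Bar m))
      + (S (Hol l) (Hol j) (Bar m) * S (Hol k) (Hol i) (Hol m) + S (Hol l) (Hol j) (Hol m) * S (Hol k) (Hol i) (Bar m)))"
    proof (rule sum.cong[OF refl])
      fix m assume m: "m \<in> {1..n}"
      show "?q m = (T (Hol k) (Hol l) (Bar m) * S (Hol m) (Hol i) (Hol j) + T (Hol k) (Hol l) (Hol m) * S (Bar m) (Hol i) (Hol j))
        - (S (Hol k) (Hol j) (Bar m) * S (Hol l) (Hol i) (Hol m) + S (Hol k) (Hol j) (Hol m) * S (Hol l) (Hol i) (Bar m))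
        + (S (Hol l) (Hol j) (Bar m) * S (Hol k) (Hol i) (Hol m) + S (Hol l) (Hol j) (Hol m) * S (Hol k) (Hol i) (Bar m))"
        using assms(1-4) m by (simp only: S1) (simp add: t_def u_def)
    qed
    then show ?thesis
      unfolding curvature_frame[OF assms(1-4)] sum.distrib[symmetric] sum_subtractf[symmetric]
      by (simp add: sum.distrib sum_subtractf)
  qed
  \<comment> \<open>The first two groups on the right are the quadratic sides of \<open>B1\<close>
    and \<open>B2\<close>, split off so that they cancel later; the other five are the quadratic
    terms of the formula.\<close>
  have "(\<Sum>m=1..n. (t k l m * (- (u m i j - u i j m + u j m i) / 2) + u k l m * (t i j m / 2))
      - ((- t k j m / 2) * (- (u l i m - u i m l + u m l i) / 2) + (- (u k j m - u j m k + u m k j) / 2) * (- t l i m / 2))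
      + ((- t l j m / 2) * (- (u k i m - u i m k + u m k i) / 2) + (- (u l j m - u j m l + u m l j) / 2) * (- t k i m / 2)))
    = (\<Sum>m=1..n. - 1/2 * (t k l m * u m i j + t l i m * u m k j + t i k m * u m l j)
      + 1/2 * (t k l m * u m j i + t l j m * u m k i + t j k m * u m l i)
      + 1/2 * (t i j m * u k l m + u i j m * t k l m)
      + 1/4 * (t i k m * (u j l m - u l m j - u m j l))
      + 1/4 * (t j l m * (u i k m - u k m i - u m i k))
      - 1/4 * (t i l m * (u j k m - u k m j - u m j k))
      - 1/4 * (t j k m * (u i l m - u l m i - u m i l)))"
  proof (intro sum.cong refl)
    fix m assume m: "m \<in> {1..n}"
    \<comment> \<open>These skew-symmetries put the lower indices in a fixed order, with the
      summation index first where it occurs among them; what remains is a polynomial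
      identity.\<close>
    note r = sw(1)[OF assms(3,2) m] sw(1)[OF assms(4,1) m] sw(1)[OF assms(4,2) m] sw(1)[OF assms(3,1) m]
      sw(2)[OF assms(2) m assms(1)] sw(2)[OF assms(1) m assms(4)] sw(2)[OF assms(2) m assms(3)]
      sw(2)[OF assms(1) m assms(3)] sw(2)[OF assms(2) m assms(4)] sw(2)[OF assms(4) m assms(2)] sw(2)[OF assms(3) m assms(1)]
      sw(2)[OF assms(3) m assms(2)] sw(2)[OF assms(4) m assms(1)]
      sw(2)[OF assms(4,1) m] sw(2)[OF assms(3,2) m] sw(2)[OF assms(3,1) m] sw(2)[OF assms(4,2) m]
    show "(t k l m * (- (u m i j - u i j m + u j m i) / 2) + u k l m * (t i j m / 2))
      - ((- t k j m / 2) * (- (u l i m - u i m l + u m l i) / 2) + (- (u k j m - u j m k + u m k j) / 2) * (- t l i m / 2))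
      + ((- t l j m / 2) * (- (u k i m - u i m k + u m k i) / 2) + (- (u l j m - u j m l + u m l j) / 2) * (- t k i m / 2))
    = - 1/2 * (t k l m * u m i j + t l i m * u m k j + t i k m * u m l j)
      + 1/2 * (t k l m * u m j i + t l j m * u m k i + t j k m * u m l i)
      + 1/2 * (t i j m * u k l m + u i j m * t k l m)
      + 1/4 * (t i k m * (u j l m - u l m j - u m j l))
      + 1/4 * (t j l m * (u i k m - u k m i - u m i k))
      - 1/4 * (t i l m * (u j k m - u k m j - u m j k))
      - 1/4 * (t j k m * (u i l m - u l m i - u m i l))"
      unfolding r by (simp add: field_simps)
  qed
  then have Q: "(\<Sum>m=1..n. (t k l m * (- (u m i j - u i j m + u j m i) / 2) + u k l m * (t i j m / 2))
      - ((- t k j m / 2) * (- (u l i m - u i m l + u m l i) / 2) + (- (u k j m - u j m k + u m k j) / 2) * (- t l i m / 2))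
      + ((- t l j m / 2) * (- (u k i m - u i m k + u m k i) / 2) + (- (u l j m - u j m l + u m l j) / 2) * (- t k i m / 2)))
    = - 1/2 * (\<Sum>m=1..n. t k l m * u m i j + t l i m * u m k j + t i k m * u m l j)
      + 1/2 * (\<Sum>m=1..n. t k l m * u m j i + t l j m * u m k i + t j k m * u m l i)
      + 1/2 * (\<Sum>m=1..n. t i j m * u k l m + u i j m * t k l m)
      + 1/4 * (\<Sum>m=1..n. t i k m * (u j l m - u l m j - u m j l))
      + 1/4 * (\<Sum>m=1..n. t j l m * (u i k m - u k m i - u m i k))
      - 1/4 * (\<Sum>m=1..n. t i l m * (u j k m - u k m j - u m j k))
      - 1/4 * (\<Sum>m=1..n. t j k m * (u i l m - u l m i - u m i l))"
    unfolding sum_distrib_left sum.distrib[symmetric] sum_subtractf[symmetric] .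
  \<comment> \<open>Two of the six terms given by the Koszul relations already have the required
    form; the other four are the ones occurring in \<open>B1\<close> and \<open>B2\<close>.\<close>
  have D: "dS (Hol k) (Hol l) (Hol i) (Hol j) - dS (Hol l) (Hol k) (Hol i) (Hol j)
    = - 1/2 * (dT (Hol k) (Hol l) (Hol i) (Hol j) + dT (Hol l) (Hol i) (Hol k) (Hol j))
      + 1/2 * (dT (Hol k) (Hol l) (Hol j) (Hol i) + dT (Hol l) (Hol j) (Hol k) (Hol i))
      + 1/2 * (dT (Hol k) (Hol i) (Hol j) (Hol l) - dT (Hol l) (Hol i) (Hol j) (Hol k))"
    unfolding dS_eq[OF h(3,4,1,2)] dS_eq[OF h(4,3,1,2)]
      dT_swap[OF h(4,3,1,2)] dT_swap[OF h(3,2,4,1)]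
    by (simp add: field_simps)
  \<comment> \<open>Linear elimination: \<open>a\<close>, \<open>b\<close>, \<open>c\<close> and
    their primed versions are the derivative terms of the two Bianchi identities, and
    \<open>s1\<close>, \<open>s2\<close> their quadratic sums.\<close>
  have "- 1/2 * (a + b) + 1/2 * (a' + b') + 1/2 * x
      + (- 1/2 * s1 + 1/2 * s2 + 1/2 * s3 + 1/4 * s4 + 1/4 * s5 - 1/4 * s6 - 1/4 * s7)
    = 1/2 * (c - c') + 1/2 * x + 1/2 * s3 + 1/4 * s4 + 1/4 * s5 - 1/4 * s6 - 1/4 * s7"
    if "a + b + c + s1 = 0" "a' + b' + c' + s2 = 0" for a b c a' b' c' x s1 s2 s3 s4 s5 s6 s7 :: complex
  proof -
    have c: "c = - (a + b + s1)" "c' = - (a' + b' + s2)"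
      using that by (simp_all add: eq_neg_iff_add_eq_0 algebra_simps)
    show ?thesis unfolding c by (simp add: field_simps)
  qed
  from this[OF B1 B2] show ?thesis
    unfolding R D Q .
qed

section \<open>Passage to the coefficients of the torsion and the final formula\<close>

lemma torsion_coeff_eq:
  assumes "a \<in> {1..n}" "b \<in> {1..n}" "m \<in> {1..n}"
  shows "torsion_coeff M nab n e p (Hol a) (Hol b) (Hol m) = T (Hol a) (Hol b) (Bar m)"
    and "torsion_coeff M nab n e p (Hol a) (Hol b) (Bar m) = T (Hol a) (Hol b) (Hol m)"
  unfolding torsion_coeff_def T_def
  using frame_coeff[OF ctorsion_frame[OF assms(1,2)[THEN hol_bar_indices(1)]] assms(3)] .

lemma torsion_deriv_coeff_eq:
  assumes "a \<in> {1..n}" "b \<in> {1..n}" "c \<in> {1..n}" "m \<in> {1..n}"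
  shows "torsion_deriv_coeff M nab n e p (Hol a) (Hol b) (Hol c) (Bar m) = dT (Hol c) (Hol a) (Hol b) (Hol m)"
proof -
  note F = assms[THEN hol_bar_indices(1), THEN cvector_field_frame]
  show ?thesis
    unfolding torsion_deriv_coeff_def dT_def
    using frame_coeff(2)[OF ctorsion_deriv_ctangent[OF F(3,1,2) p] assms(4)] .
qed

end

theorem theorem3p3:
  fixes M :: "('a, 'e::euclidean_space) manifold"
    and J :: "'a \<Rightarrow> 'a tvec \<Rightarrow> 'a tvec"
    and g :: "'a \<Rightarrow> 'a tvec \<Rightarrow> 'a tvec \<Rightarrow> real"
    and D nab :: "'a conn"
    and n :: nat
    and e :: "nat \<Rightarrow> 'a \<Rightarrow> 'a ctvec"
  defines "R \<equiv> curvature_coeff M g D e"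
    and "\<tau> \<equiv> torsion_coeff M nab n e"
    and "d\<tau> \<equiv> torsion_deriv_coeff M nab n e"
  assumes "almost_hermitian_manifold n M J g"
    and "levi_civita_connection M g D"
    and "canonical_connection M J g nab"
    and "unitary_frame n M J g U e"
    and "p \<in> U"
    and "i \<in> {1..n}" and "j \<in> {1..n}" and "k \<in> {1..n}" and "l \<in> {1..n}"
  shows "R p (Hol i) (Hol j) (Hol k) (Hol l) =
      1/2 * (d\<tau> p (Hol k) (Hol l) (Hol i) (Bar j) - d\<tau> p (Hol k) (Hol l) (Hol j) (Bar i))
    + 1/2 * (d\<tau> p (Hol i) (Hol j) (Hol k) (Bar l) - d\<tau> p (Hol i) (Hol j) (Hol l) (Bar k))
    + 1/2 * (\<Sum>m=1..n. \<tau> p (Hol i) (Hol j) (Hol m) * \<tau> p (Hol k) (Hol l) (Bar m)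
                     + \<tau> p (Hol i) (Hol j) (Bar m) * \<tau> p (Hol k) (Hol l) (Hol m))
    + 1/4 * (\<Sum>m=1..n. \<tau> p (Hol i) (Hol k) (Hol m) *
        (\<tau> p (Hol j) (Hol l) (Bar m) - \<tau> p (Hol l) (Hol m) (Bar j) - \<tau> p (Hol m) (Hol j) (Bar l)))
    + 1/4 * (\<Sum>m=1..n. \<tau> p (Hol j) (Hol l) (Hol m) *
        (\<tau> p (Hol i) (Hol k) (Bar m) - \<tau> p (Hol k) (Hol m) (Bar i) - \<tau> p (Hol m) (Hol i) (Bar k)))
    - 1/4 * (\<Sum>m=1..n. \<tau> p (Hol i) (Hol l) (Hol m) *
        (\<tau> p (Hol j) (Hol k) (Bar m) - \<tau> p (Hol k) (Hol m) (Bar j) - \<tau> p (Hol m) (Hol j) (Bar k)))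
    - 1/4 * (\<Sum>m=1..n. \<tau> p (Hol j) (Hol k) (Hol m) *
        (\<tau> p (Hol i) (Hol l) (Bar m) - \<tau> p (Hol l) (Hol m) (Bar i) - \<tau> p (Hol m) (Hol i) (Bar l)))"
proof -
  note lc = assms(5)[unfolded levi_civita_connection_def]
  note cc = assms(6)[unfolded canonical_connection_def]
  note sm = almost_hermitian_manifold.axioms(1)[OF assms(4)]
  have mc: "metric_connection n M J g D" "metric_connection n M J g nab"
    using lc cc assms(4) sm
    by (auto intro!: metric_connection.intro manifold_connection.intro metric_connection_axioms.intro)
  interpret canonical_and_levi_civita_frame n M J g D nab U e p
  proof (intro canonical_and_levi_civita_frame.intro canonical_and_levi_civita.intro mc
      unitary_frame_at.intro assms(4))
    show "canonical_and_levi_civita_axioms M J D nab"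
      using lc cc unfolding canonical_and_levi_civita_axioms_def by blast
    show "unitary_frame_at_axioms n M J g U e p"
      using assms(7,8) by (rule unitary_frame_at_axioms.intro)
  qed
  show ?thesis
    unfolding R_def \<tau>_def d\<tau>_def curvature_frame_torsion[OF assms(9-12)]
    using assms(9-12)
    \<comment> \<open>Both sides have the same shape, so they are compared summand by summand;
      \<open>sum.cong\<close> provides the range of \<open>m\<close> that
      \<open>torsion_coeff_eq\<close> requires.\<close>
    by (intro arg_cong2[where f = "(+)"] arg_cong2[where f = "(-)"] arg_cong2[where f = "(*)"] sum.cong refl)
      (simp_all add: torsion_coeff_eq torsion_deriv_coeff_eq)
qed

end
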